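(* Let $\mathbf g=(g_1,\dots,g_m)\in M^1(\mathbb R^n)\otimes\mathbb C^m$ generate a multi-window Gabor frame over $\Lambda_D$, and let $\alpha\in\mathbb C^m$ be such that $v_\alpha=\sum_{s=1}^m\overline{\alpha_s}\mathcal Z_Dg_s(0,0)$ equals $$v_\alpha=\mathsf h_{d_1}^{\lambda_1}\otimes\cdots\otimes\mathsf h_{d_n}^{\lambda_n},\qquad\lambda_j>0,$$ where $\mathsf h_{d_j}^{\lambda_j}\in\mathbb C^{d_j}$ is the sampled and periodized Gaussian. For each $j=1,\dots,n$ let $Q_j\subseteq\mathbb Z_{d_j}^2$ with $|Q_j|=d_j$ consist of distinct points, and assume that either $d_j$ is odd or $\sum_{q_j\in Q_j}q_j\neq(0,0)$ in $\mathbb Z_{d_j}^2$. Put $Q:=Q_1\times\cdots\times Q_n\subseteq K_D$ (under $K_D\cong\prod_j\mathbb Z_{d_j}^2$). Then $\{\mathsf W_qv_\alpha:q\in Q\}$ is a basis of $\mathcal H_{\mathbf d}$. Consequently, the restricted coefficient family $\{B_0(c)_q:q\in Q\}$, where $B_0(c)_q=\frac1{\sqrt d\,\|v_\alpha\|}\langle c,\mathsf W_qv_\alpha\rangle$, determines every $c\in\mathcal H_{\mathbf d}$ using the minimal possible number $d$ of scalar coefficients.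
   Context: Inner products are linear in the first variable. $D=\operatorname{diag}(d_1,\dots,d_n)$, positive integers $d_1\mid\cdots\mid d_n$, $d=\prod_jd_j$; $\Lambda_D=D^{1/2}\mathbb Z^n\times D^{1/2}\mathbb Z^n$, $\Lambda_D^\circ=D^{-1/2}\mathbb Z^n\times D^{-1/2}\mathbb Z^n$. $\rho(x,\omega)=e^{-\pi i x\cdot\omega}M_\omega T_x$ with $(T_xf)(t)=f(t-x)$, $(M_\omega f)(t)=e^{2\pi i\omega\cdot t}f(t)$; $M^1(\mathbb R^n)$ is the Feichtinger algebra; $\mathbf g$ generates a multi-window Gabor frame over $\Lambda_D$ if $\{\rho(\lambda)g_j:\lambda\in\Lambda_D,1\le j\le m\}$ is a frame of $L^2(\mathbb R^n)$. $\mathbb Z_{\mathbf d}=\prod_j\mathbb Z_{d_j}$, $\mathcal H_{\mathbf d}=\bigotimes_j\mathbb C^{d_j}$ with orthonormal basis $(e_r)_{r\in\mathbb Z_{\mathbf d}}$, $\delta_r=D^{-1/2}r$. For $h\in M^1(\mathbb R^n)$, $Z_Dh(x,\omega)=\sum_{\gamma\in D^{1/2}\mathbb Z^n}h(x-\gamma)e^{2\pi i\gamma\cdot\omega}$ and $(\mathcal Z_Dh(x,\omega))_r=e^{-2\pi i\delta_r\cdot\omega}Z_Dh(x+\delta_r,\omega)$. $K_D=\Lambda_D^\circ/\Lambda_D\cong\mathbb Z_{\mathbf d}\times\mathbb Z_{\mathbf d}\cong\prod_{j}\mathbb Z_{d_j}^2$; for $q=(r,s)$ with fixed integer representatives, $\mathsf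 W_q=e^{\pi i r^TD^{-1}s}X_1^{r_1}\cdots X_n^{r_n}Z_1^{s_1}\cdots Z_n^{s_n}$, where $X_ie_r=e_{r+\varepsilon_i}$ ($\varepsilon_i$ the $i$-th standard basis vector), $Z_ie_r=e^{2\pi i r_i/d_i}e_r$. Sampled and periodized Gaussian: for $N\in\mathbb N$ and $\lambda>0$, $\mathsf h_N^\lambda\in\mathbb C^N$ is, up to a nonzero scalar factor, $(\mathsf h_N^\lambda)_k=\sum_{\ell\in\mathbb Z}e^{-\pi\lambda(k+\ell N)^2/N}$, $k\in\mathbb Z_N$ (since $\lambda>0$ is arbitrary, the precise parametrization of the width is immaterial). *)

theory Defs
  imports
    "HOL-Analysis.Analysis"
    "HOL-Library.Function_Algebras"
    "HOL-Number_Theory.Cong"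
begin

section \<open>Gabor frames in $L^2(R^n)$\<close>

text \<open>Elements of $L^2$ are represented by Borel functions; no quotient by null sets is taken.\<close>

definition L2 :: "(real^'n \<Rightarrow> complex) set" where
  "L2 = {f \<in> borel_measurable lborel. integrable lborel (\<lambda>t. (cmod (f t))\<^sup>2)}"

definition L2_inner :: "(real^'n \<Rightarrow> complex) \<Rightarrow> (real^'n \<Rightarrow> complex) \<Rightarrow> complex" where
  "L2_inner f g = (LINT t|lborel. f t * cnj (g t))"

definition transl :: "real^'n \<Rightarrow> (real^'n \<Rightarrow> complex) \<Rightarrow> (real^'n \<Rightarrow> complex)" where
  "transl x f = (\<lambda>t. f (t - x))"

definition modul :: "real^'n \<Rightarrow> (real^'n \<Rightarrow> complex) \<Rightarrow> (real^'n \<Rightarrow> complex)" where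
  "modul \<omega> f = (\<lambda>t. cis (2 * pi * (\<omega> \<bullet> t)) * f t)"

definition tf_shift :: "(real^'n) \<times> (real^'n) \<Rightarrow> (real^'n \<Rightarrow> complex) \<Rightarrow> (real^'n \<Rightarrow> complex)" where
  "tf_shift = (\<lambda>(x, \<omega>) f t. cis (- pi * (x \<bullet> \<omega>)) * modul \<omega> (transl x f) t)"

text \<open>The Feichtinger algebra: square-integrable functions whose short-time Fourier transform
  with respect to the Gaussian window is integrable on phase space.  Every class in $M^1$ has a
  unique continuous representative, and that representative is the one meant here, since the Zak
  transform is evaluated pointwise.\<close>

definition gauss :: "real^'n \<Rightarrow> complex" where
  "gauss t = of_real (exp (- pi * (t \<bullet> t)))"

definition M1 :: "(real^'n \<Rightarrow> complex) set" where
  "M1 = {f \<in> L2. continuous_on UNIV f \<and>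
     integrable lborel (\<lambda>(x, \<omega>). L2_inner f (modul \<omega> (transl x gauss)))}"

definition is_frame :: "'i set \<Rightarrow> ('i \<Rightarrow> real^'n \<Rightarrow> complex) \<Rightarrow> bool" where
  "is_frame I \<phi> \<longleftrightarrow> (\<forall>i\<in>I. \<phi> i \<in> L2) \<and>
     (\<exists>A B. 0 < A \<and> 0 < B \<and> (\<forall>f\<in>L2.
        (\<lambda>i. (cmod (L2_inner f (\<phi> i)))\<^sup>2) summable_on I \<and>
        A * (LINT t|lborel. (cmod (f t))\<^sup>2) \<le> (\<Sum>\<^sub>\<infinity>i\<in>I. (cmod (L2_inner f (\<phi> i)))\<^sup>2) \<and>
        (\<Sum>\<^sub>\<infinity>i\<in>I. (cmod (L2_inner f (\<phi> i)))\<^sup>2) \<le> B * (LINT t|lborel. (cmod (f t))\<^sup>2)))"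

definition D_half :: "('n::finite \<Rightarrow> nat) \<Rightarrow> int^'n \<Rightarrow> real^'n" where
  "D_half d k = (\<chi> j. sqrt (real (d j)) * of_int (k $ j))"

definition D_mhalf :: "('n::finite \<Rightarrow> nat) \<Rightarrow> int^'n \<Rightarrow> real^'n" where
  "D_mhalf d k = (\<chi> j. of_int (k $ j) / sqrt (real (d j)))"

definition Lambda :: "('n::finite \<Rightarrow> nat) \<Rightarrow> ((real^'n) \<times> (real^'n)) set" where
  "Lambda d = range (D_half d) \<times> range (D_half d)"

definition multiwindow_gabor_frame ::
  "('n::finite \<Rightarrow> nat) \<Rightarrow> ('m::finite \<Rightarrow> real^'n \<Rightarrow> complex) \<Rightarrow> bool" where
  "multiwindow_gabor_frame d g \<longleftrightarrow>
     is_frame (Lambda d \<times> UNIV) (\<lambda>(z, j). tf_shift z (g j))"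

section \<open>The finite-dimensional space\<close>

definition cscale :: "complex \<Rightarrow> ('a \<Rightarrow> complex) \<Rightarrow> ('a \<Rightarrow> complex)" where
  "cscale a f = (\<lambda>k. a * f k)"

interpretation cfun: vector_space "cscale :: complex \<Rightarrow> ('a \<Rightarrow> complex) \<Rightarrow> _"
  by unfold_locales (auto simp: cscale_def fun_eq_iff algebra_simps)

text \<open>Residue classes in $Z_{d_1} \times \dots \times Z_{d_n}$ are given by their least
  nonnegative representatives.\<close>

definition Zd :: "('n::finite \<Rightarrow> nat) \<Rightarrow> (int^'n) set" where
  "Zd d = {r. \<forall>j. 0 \<le> r $ j \<and> r $ j < int (d j)}"

definition cong_d :: "('n::finite \<Rightarrow> nat) \<Rightarrow> int^'n \<Rightarrow> int^'n \<Rightarrow> bool" where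
  "cong_d d r r' \<longleftrightarrow> (\<forall>j. [r $ j = r' $ j] (mod int (d j)))"

text \<open>A vector $\sum_r c_r e_r$ is identified with the function $r \mapsto c_r$ on
  $Z_{d_1} \times \dots \times Z_{d_n}$, and this with its $d$-periodic lift to $Z^n$.\<close>

definition Hd :: "('n::finite \<Rightarrow> nat) \<Rightarrow> (int^'n \<Rightarrow> complex) set" where
  "Hd d = {c. \<forall>r r'. cong_d d r r' \<longrightarrow> c r = c r'}"

definition Hd_inner :: "('n::finite \<Rightarrow> nat) \<Rightarrow> (int^'n \<Rightarrow> complex) \<Rightarrow> (int^'n \<Rightarrow> complex) \<Rightarrow> complex" where
  "Hd_inner d c c' = (\<Sum>r\<in>Zd d. c r * cnj (c' r))"

definition Hd_norm :: "('n::finite \<Rightarrow> nat) \<Rightarrow> (int^'n \<Rightarrow> complex) \<Rightarrow> real" where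
  "Hd_norm d c = sqrt (\<Sum>r\<in>Zd d. (cmod (c r))\<^sup>2)"

definition e_vec :: "('n::finite \<Rightarrow> nat) \<Rightarrow> int^'n \<Rightarrow> (int^'n \<Rightarrow> complex)" where
  "e_vec d r = (\<lambda>k. if cong_d d k r then 1 else 0)"

definition tensor :: "('n::finite \<Rightarrow> int \<Rightarrow> complex) \<Rightarrow> (int^'n \<Rightarrow> complex)" where
  "tensor h = (\<lambda>r. \<Prod>j\<in>UNIV. h j (r $ j))"

section \<open>Zak transform\<close>

definition zak :: "('n::finite \<Rightarrow> nat) \<Rightarrow> (real^'n \<Rightarrow> complex) \<Rightarrow> real^'n \<Rightarrow> real^'n \<Rightarrow> complex" where
  "zak d h x \<omega> = (\<Sum>\<^sub>\<infinity>\<gamma>\<in>range (D_half d). h (x - \<gamma>) * cis (2 * pi * (\<gamma> \<bullet> \<omega>)))"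

text \<open>For \<open>h \<in> M1\<close>, quasi-periodicity of \<^const>\<open>zak\<close> makes this
  $d$-periodic in the index \<open>r\<close>, hence an element of \<^const>\<open>Hd\<close>.\<close>

definition zak_vec ::
  "('n::finite \<Rightarrow> nat) \<Rightarrow> (real^'n \<Rightarrow> complex) \<Rightarrow> real^'n \<Rightarrow> real^'n \<Rightarrow> (int^'n \<Rightarrow> complex)" where
  "zak_vec d h x \<omega> =
     (\<lambda>r. cis (- 2 * pi * (D_mhalf d r \<bullet> \<omega>)) * zak d h (x + D_mhalf d r) \<omega>)"

section \<open>Finite Weyl operators\<close>

definition X_op :: "'n::finite \<Rightarrow> (int^'n \<Rightarrow> complex) \<Rightarrow> (int^'n \<Rightarrow> complex)" where
  "X_op i c = (\<lambda>k. c (k - axis i 1))"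

definition Z_op :: "('n::finite \<Rightarrow> nat) \<Rightarrow> 'n \<Rightarrow> (int^'n \<Rightarrow> complex) \<Rightarrow> (int^'n \<Rightarrow> complex)" where
  "Z_op d i c = (\<lambda>k. cis (2 * pi * of_int (k $ i) / real (d i)) * c k)"

definition op_powi :: "('a \<Rightarrow> 'a) \<Rightarrow> int \<Rightarrow> ('a \<Rightarrow> 'a)" where
  "op_powi T k = (if 0 \<le> k then T ^^ nat k else inv T ^^ nat (- k))"

definition op_prod :: "('n::{finite,linorder} \<Rightarrow> 'a \<Rightarrow> 'a) \<Rightarrow> ('a \<Rightarrow> 'a)" where
  "op_prod T = foldr (\<circ>) (map T (sorted_list_of_set UNIV)) id"

definition weyl :: "('n::{finite,linorder} \<Rightarrow> nat) \<Rightarrow> (int, 'n) vec \<times> (int, 'n) vec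
    \<Rightarrow> ((int, 'n) vec \<Rightarrow> complex) \<Rightarrow> ((int, 'n) vec \<Rightarrow> complex)" where
  "weyl d = (\<lambda>(r, s) c.
     cscale (cis (pi * (\<Sum>j\<in>UNIV. of_int (r $ j) * of_int (s $ j) / real (d j))))
       (op_prod (\<lambda>i. op_powi (X_op i) (r $ i)) (op_prod (\<lambda>i. op_powi (Z_op d i) (s $ i)) c)))"

lemma X_op_e_vec: "X_op i (e_vec d r) = e_vec d (r + axis i 1)"
proof -
  have "cong_d d (k - axis i 1) r \<longleftrightarrow> cong_d d k (r + axis i 1)" for k
    by (simp add: cong_d_def cong_iff_dvd_diff algebra_simps)
  then show ?thesis by (simp add: X_op_def e_vec_def)
qed

lemma Z_op_e_vec:
  assumes "d i > 0"
  shows "Z_op d i (e_vec d r) = cscale (cis (2 * pi * of_int (r $ i) / real (d i))) (e_vec d r)"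
proof -
  have "cis (2 * pi * of_int (k $ i) / real (d i)) = cis (2 * pi * of_int (r $ i) / real (d i))"
    if c: "cong_d d k r" for k
  proof -
    obtain q where q: "k $ i = r $ i + int (d i) * q"
      using c unfolding cong_d_def by (metis cong_iff_lin cong_sym)
    have "2 * pi * of_int (k $ i) / real (d i) =
        2 * pi * of_int (r $ i) / real (d i) + 2 * pi * of_int q"
      using assms unfolding q by (simp add: field_simps)
    then show ?thesis by (simp add: cis_mult [symmetric] cis_multiple_2pi)
  qed
  then show ?thesis by (auto simp: Z_op_def e_vec_def cscale_def fun_eq_iff)
qed

section \<open>Index sets, Gaussians and coefficients\<close>

text \<open>$K_D$ as $Z_{\mathbf d} \times Z_{\mathbf d}$, the pair $(r,s)$ standing for the class of
  $(D^{-1/2} r, D^{-1/2} s)$ modulo \<^const>\<open>Lambda\<close>.\<close>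

definition KD :: "('n::finite \<Rightarrow> nat) \<Rightarrow> ((int^'n) \<times> (int^'n)) set" where
  "KD d = Zd d \<times> Zd d"

definition Q_prod :: "('n::finite \<Rightarrow> (int \<times> int) set) \<Rightarrow> ((int^'n) \<times> (int^'n)) set" where
  "Q_prod Q = {(r, s). \<forall>j. (r $ j, s $ j) \<in> Q j}"

text \<open>A choice of integer representatives for the elements of \<^const>\<open>KD\<close>; the phase of
  \<^const>\<open>weyl\<close> depends on it.\<close>

definition is_repr ::
  "('n::finite \<Rightarrow> nat) \<Rightarrow> ((int^'n) \<times> (int^'n) \<Rightarrow> (int^'n) \<times> (int^'n)) \<Rightarrow> bool" where
  "is_repr d \<rho> \<longleftrightarrow> (\<forall>q\<in>KD d. cong_d d (fst (\<rho> q)) (fst q) \<and> cong_d d (snd (\<rho> q)) (snd q))"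

text \<open>The sampled and periodized Gaussian is determined only up to a nonzero factor.\<close>

definition is_sampled_gaussian :: "nat \<Rightarrow> real \<Rightarrow> (int \<Rightarrow> complex) \<Rightarrow> bool" where
  "is_sampled_gaussian N l h \<longleftrightarrow> (\<exists>\<kappa>. \<kappa> \<noteq> 0 \<and> (\<forall>k. h k = \<kappa> *
     of_real (\<Sum>\<^sub>\<infinity>p\<in>UNIV. exp (- pi * l * (of_int (k + p * int N))\<^sup>2 / real N))))"

definition B0 :: "('n::{finite,linorder} \<Rightarrow> nat) \<Rightarrow> ((int, 'n) vec \<Rightarrow> complex)
    \<Rightarrow> (int, 'n) vec \<times> (int, 'n) vec \<Rightarrow> ((int, 'n) vec \<Rightarrow> complex) \<Rightarrow> complex" where
  "B0 d v q c = 1 / of_real (sqrt (real (\<Prod>j\<in>UNIV. d j)) * Hd_norm d v) * Hd_inner d c (weyl d q v)"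

definition determines :: "'i set \<Rightarrow> ('i \<Rightarrow> 'v \<Rightarrow> complex) \<Rightarrow> 'v set \<Rightarrow> bool" where
  "determines I \<phi> V \<longleftrightarrow> (\<forall>c\<in>V. \<forall>c'\<in>V. (\<forall>i\<in>I. \<phi> i c = \<phi> i c') \<longrightarrow> c = c')"

definition linear_functional_on :: "('a \<Rightarrow> complex) set \<Rightarrow> (('a \<Rightarrow> complex) \<Rightarrow> complex) \<Rightarrow> bool" where
  "linear_functional_on V \<phi> \<longleftrightarrow>
     (\<forall>c\<in>V. \<forall>c'\<in>V. \<phi> (c + c') = \<phi> c + \<phi> c') \<and> (\<forall>a. \<forall>c\<in>V. \<phi> (cscale a c) = a * \<phi> c)"

end

theory Submission
  imports Defs "HOL-Complex_Analysis.Complex_Analysis"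
begin

text \<open>Everything reduces to one coordinate.  If $c \in C^N$ is orthogonal to the Weyl translates of
  the periodized Gaussian $h$ indexed by $Q$, then, with $T = 2\pi\lambda$, the entire function
  $F(z) = \sum_{k \in Z} c_k e^{-\pi\lambda k^2/N + kz}$ has period $2\pi i$, satisfies
  $F(z - T) = e^{TN/2 - Nz} F(z)$, and vanishes at the $N$ points $(Tr - 2\pi i s)/N$ with
  $(r,s) \in Q$.  These are pairwise incongruent modulo the period lattice, so dividing $F$ by
  translates of an explicit entire function with simple zeros exactly on the lattice leaves an entire
  $G$ with $G(z - T) = C G(z)$.  By Liouville's theorem $G$ is $0$ or $K e^{az}$ with $a$ an integer;
  the latter forces $N$ to be even and the sum of $Q$ to vanish modulo $N$.  Hence $F = 0$, and then
  $c = 0$ because $h$ has no zeros.  Injective coordinate maps have left inverses, whose tensor product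
  inverts the full analysis map.\<close>

text \<open>The zeros come from completing the square: at the point attached to (r,s), the Gaussian
  exponent of \<open>F\<close> becomes that of the translate by r, up to a factor independent of k.
  The obstacle is that \<open>N\<close> zeros alone do not force a theta function of degree
  \<open>N\<close> to vanish: a nonzero one may have \<open>N\<close> zeros per period cell, but
  their sum is then fixed modulo the lattice. The multiplier e^(TN/2) makes the critical sum of the
  first coordinates N^2/2 modulo N. This is not an integer for odd N and is 0 modulo N for even N,
  whence the parity alternative in the hypothesis. The number of zeros and their sum are controlled
  together by dividing out one zero at a time, without contour integrals: each division lowers the
  degree by one and stores the zero in the multiplier.\<close>

section \<open>Power series that converge everywhere\<close>

lemma summable_power_series_ratio_0:
  fixes c :: "nat \<Rightarrow> complex"
  assumes ratio: "\<And>n. norm (c (Suc n)) \<le> r n * norm (c n)" and r: "r \<longlonglongrightarrow> 0"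
  shows "summable (\<lambda>n. c n * w ^ n)"
proof -
  have "(\<lambda>n. r n * norm w) \<longlonglongrightarrow> 0 * norm w"
    by (intro tendsto_intros r)
  then have "eventually (\<lambda>n. r n * norm w < 1/2) sequentially"
    by (rule order_tendstoD) auto
  then obtain M where M: "\<And>n. n \<ge> M \<Longrightarrow> r n * norm w < 1/2"
    by (auto simp: eventually_sequentially)
  show ?thesis
  proof (rule summable_ratio_test[of "1/2" M])
    fix n assume n: "n \<ge> M"
    have "norm (c (Suc n) * w ^ Suc n) \<le> (r n * norm (c n)) * norm w ^ Suc n"
      unfolding norm_mult norm_power by (intro mult_right_mono ratio) auto
    also have "\<dots> = (r n * norm w) * norm (c n * w ^ n)"
      by (simp add: norm_mult norm_power)
    also have "\<dots> \<le> 1/2 * norm (c n * w ^ n)"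
      using M[OF n] by (intro mult_right_mono) auto
    finally show "norm (c (Suc n) * w ^ Suc n) \<le> 1/2 * norm (c n * w ^ n)" .
  qed simp
qed

lemma entire_power_series:
  fixes c :: "nat \<Rightarrow> complex"
  assumes "\<And>w. summable (\<lambda>n. c n * w ^ n)"
  shows "(\<lambda>w. \<Sum>n. c n * w ^ n) holomorphic_on UNIV"
  using termdiffs_strong_converges_everywhere[OF assms]
  by (auto simp: holomorphic_on_def field_differentiable_def intro: has_field_derivative_at_within)

section \<open>An entire function with simple zeros on a lattice\<close>

text \<open>In closed form the n-th coefficient is (-1)^n q^(n(n-1)/2) / ((1-q)(1-q^2)...(1-q^n)).
  The recursive form is what the ratio test and the functional equation use.\<close>

fun q_coeff :: "real \<Rightarrow> nat \<Rightarrow> complex" where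
  "q_coeff q 0 = 1"
| "q_coeff q (Suc n) = - of_real (q ^ n / (1 - q ^ Suc n)) * q_coeff q n"

text \<open>Euler's expansion of $\prod_{n \ge 0} (1 - q^n w)$.\<close>

definition q_poch :: "real \<Rightarrow> complex \<Rightarrow> complex" where
  "q_poch q w = (\<Sum>n. q_coeff q n * w ^ n)"

context
  fixes q :: real
  assumes q: "0 < q" "q < 1"
begin

lemma summable_q_coeff: "summable (\<lambda>n. q_coeff q n * w ^ n)"
proof (rule summable_power_series_ratio_0[where r = "\<lambda>n. q ^ n / (1 - q)"])
  fix n
  have "q ^ Suc n \<le> q"
    using q power_decreasing[of 1 "Suc n" q] by simp
  with q have pos: "1 - q ^ Suc n > 0" and le: "1 - q \<le> 1 - q ^ Suc n" by linarith+
  have "q ^ n / (1 - q ^ Suc n) \<le> q ^ n / (1 - q)"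
    using q pos le by (intro divide_left_mono mult_pos_pos) auto
  moreover have "q ^ n / (1 - q ^ Suc n) \<ge> 0"
    using q pos by (intro divide_nonneg_pos) auto
  ultimately show "norm (q_coeff q (Suc n)) \<le> q ^ n / (1 - q) * norm (q_coeff q n)"
    by (simp only: q_coeff.simps norm_mult norm_minus_cancel norm_of_real abs_of_nonneg)
       (intro mult_right_mono, auto)
next
  have "(\<lambda>n. q ^ n / (1 - q)) \<longlonglongrightarrow> 0 / (1 - q)"
    using q by (intro tendsto_intros) auto
  then show "(\<lambda>n. q ^ n / (1 - q)) \<longlonglongrightarrow> 0" by simp
qed

lemma q_poch_holomorphic: "q_poch q holomorphic_on UNIV"
  using entire_power_series[OF summable_q_coeff] by (simp add: q_poch_def[abs_def])

lemma q_poch_0 [simp]: "q_poch q 0 = 1"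
  by (simp add: q_poch_def)

text \<open>Comparing coefficients of w^(n+1), the equation amounts to c_(n+1) (1 - q^(n+1)) = - q^n
  c_n, which is the recursion of \<open>q_coeff\<close>. It replaces the infinite product: each
  application splits off one factor.\<close>

lemma q_poch_rec: "q_poch q w = (1 - w) * q_poch q (of_real q * w)"
proof -
  define b where "b = (\<lambda>n. q_coeff q n * (of_real q * w) ^ n)"
  have sb: "summable b" unfolding b_def by (rule summable_q_coeff)
  have step: "q_coeff q (Suc n) * w ^ Suc n = b (Suc n) - w * b n" for n
  proof -
    have "q ^ Suc n < 1" using q by (metis power_Suc_less_one)
    then have ne: "(1::complex) - of_real q ^ Suc n \<noteq> 0"
      by (metis eq_iff_diff_eq_0 of_real_1 of_real_eq_iff of_real_power less_irrefl)
    have "q_coeff q (Suc n) * (1 - of_real q ^ Suc n) = - (of_real q ^ n) * q_coeff q n"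
      using ne by (simp add: field_simps)
    then have "q_coeff q (Suc n) = q_coeff q (Suc n) * of_real q ^ Suc n - of_real q ^ n * q_coeff q n"
      by (simp add: algebra_simps del: q_coeff.simps)
    then have "q_coeff q (Suc n) * w ^ Suc n =
        (q_coeff q (Suc n) * of_real q ^ Suc n - of_real q ^ n * q_coeff q n) * w ^ Suc n"
      by (rule arg_cong)
    then show ?thesis
      by (simp add: b_def power_mult_distrib algebra_simps del: q_coeff.simps)
  qed
  have "q_poch q w = 1 + (\<Sum>n. q_coeff q (Suc n) * w ^ Suc n)"
    unfolding q_poch_def using suminf_split_head[OF summable_q_coeff[of w]] by simp
  also have "\<dots> = 1 + (\<Sum>n. b (Suc n) - w * b n)"
    by (simp only: step)
  also have "\<dots> = 1 + ((\<Sum>n. b (Suc n)) - w * (\<Sum>n. b n))"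
    using sb by (simp add: suminf_diff[symmetric] summable_Suc_iff summable_mult suminf_mult)
  also have "(\<Sum>n. b (Suc n)) = (\<Sum>n. b n) - 1"
    using suminf_split_head[OF sb] by (simp add: b_def)
  finally show ?thesis
    by (simp add: q_poch_def b_def algebra_simps)
qed

text \<open>If no factor 1 - q^n w vanishes, the functional equation carries a zero at w to q w, q^2
  w, and so on. These points tend to 0, where the continuous function has the value 1.\<close>

lemma q_poch_eq_0_imp:
  assumes "q_poch q w = 0"
  shows "\<exists>n. of_real (q ^ n) * w = 1"
proof (rule ccontr)
  assume neg: "\<not> ?thesis"
  have zero: "q_poch q (of_real (q ^ n) * w) = 0" for n
  proof (induction n)
    case (Suc n)
    with neg q_poch_rec[of "of_real (q ^ n) * w"] show ?case
      by (auto simp: mult_ac)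
  qed (use assms in simp)
  have "(\<lambda>n. of_real (q ^ n) * w) \<longlonglongrightarrow> of_real 0 * w"
    using q by (intro tendsto_intros LIMSEQ_power_zero) auto
  moreover have "isCont (q_poch q) 0"
    using holomorphic_on_imp_continuous_on[OF q_poch_holomorphic]
    by (simp add: continuous_on_eq_continuous_at)
  ultimately have "(\<lambda>n. q_poch q (of_real (q ^ n) * w)) \<longlonglongrightarrow> q_poch q 0"
    by (intro isCont_tendsto_compose[of 0 "q_poch q"]) simp_all
  then have "q_poch q 0 = 0"
    by (simp only: zero LIMSEQ_const_iff)
  then show False by simp
qed

lemma q_poch_neq_0:
  assumes "norm w < 1"
  shows "q_poch q w \<noteq> 0"
proof
  assume "q_poch q w = 0"
  then obtain n where "of_real (q ^ n) * w = 1"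
    using q_poch_eq_0_imp by blast
  then have "q ^ n * norm w = 1"
    using q by (metis abs_of_pos norm_mult norm_of_real norm_one zero_less_power)
  moreover have "q ^ n * norm w \<le> 1 * norm w"
    using q by (intro mult_right_mono power_le_one) auto
  ultimately show False using assms by simp
qed

end

definition period_lattice :: "real \<Rightarrow> complex set" where
  "period_lattice T = {of_int k * (2 * pi * \<i>) + of_int l * of_real T | k l. True}"

text \<open>With q = e^(-T) this is the product over n >= 0 of (1 - q^n e^z)(1 - q^(n+1) e^(-z)),
  which by the Jacobi triple product is a theta function of degree one up to a constant.\<close>

definition lattice_fn :: "real \<Rightarrow> complex \<Rightarrow> complex" where
  "lattice_fn T z = q_poch (exp (- T)) (exp z) * q_poch (exp (- T)) (exp (- z - of_real T))"

lemma period_latticeI: "of_int k * (2 * pi * \<i>) + of_int l * of_real T \<in> period_lattice T"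
  by (auto simp: period_lattice_def)

lemma exp_eq_1_imp: "exp (z::complex) = 1 \<Longrightarrow> \<exists>k. z = of_int k * (2 * pi * \<i>)"
  using exp_eq[of z 0] by (auto simp: mult_ac)

context
  fixes T :: real
  assumes T: "T > 0"
begin

lemma lattice_fn_holomorphic: "lattice_fn T holomorphic_on UNIV"
proof -
  have "q_poch (exp (- T)) holomorphic_on UNIV"
    using T by (intro q_poch_holomorphic) auto
  then have "(q_poch (exp (- T)) \<circ> g) holomorphic_on UNIV" if "g holomorphic_on UNIV" for g
    using that by (meson holomorphic_on_compose_gen subset_UNIV image_subset_iff UNIV_I)
  note comp = this[unfolded o_def]
  show ?thesis
    unfolding lattice_fn_def[abs_def] by (intro holomorphic_on_mult comp holomorphic_intros)
qed

lemma lattice_fn_periodic: "lattice_fn T (z + 2 * pi * \<i>) = lattice_fn T z"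
proof -
  have "exp (z + 2 * pi * \<i>) = exp z" by (simp add: exp_add)
  moreover have "exp (- (z + 2 * pi * \<i>) - of_real T) = exp (- z - of_real T)"
    by (simp add: exp_diff exp_minus exp_add)
  ultimately show ?thesis by (simp add: lattice_fn_def)
qed

text \<open>Isolates the single factor that vanishes at 0. Both the shift rule and the simplicity of
  that zero are read off from this form.\<close>

lemma lattice_fn_factor:
  "lattice_fn T z = (1 - exp z) * (q_poch (exp (- T)) (exp (z - of_real T)) * q_poch (exp (- T)) (exp (- z - of_real T)))"
proof -
  have "q_poch (exp (- T)) (exp z) = (1 - exp z) * q_poch (exp (- T)) (exp (z - of_real T))"
    using q_poch_rec[of "exp (- T)" "exp z"] T
    by (simp add: exp_diff exp_minus field_simps exp_of_real)
  then show ?thesis by (simp add: lattice_fn_def)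
qed

text \<open>The shift removes the factor 1 - e^z from one product and adds 1 - e^(-z) to the other;
  their quotient is the multiplier -e^(-z).\<close>

lemma lattice_fn_shift: "lattice_fn T (z - of_real T) = - exp (- z) * lattice_fn T z"
proof -
  have "lattice_fn T (z - of_real T) = q_poch (exp (- T)) (exp (z - of_real T)) * q_poch (exp (- T)) (exp (- z))"
    by (simp add: lattice_fn_def)
  also have "q_poch (exp (- T)) (exp (- z)) = (1 - exp (- z)) * q_poch (exp (- T)) (exp (- z - of_real T))"
    using q_poch_rec[of "exp (- T)" "exp (- z)"] T
    by (simp add: exp_diff exp_minus field_simps exp_of_real)
  also have "1 - exp (- z) = - exp (- z) * (1 - exp z)"
    by (simp add: exp_minus field_simps)
  finally show ?thesis by (simp add: lattice_fn_factor mult_ac)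
qed

text \<open>The first product accounts for the lattice points with nonnegative multiple of
  \<open>T\<close>, the second for those with negative multiple.\<close>

lemma lattice_fn_eq_0_imp:
  assumes "lattice_fn T z = 0"
  shows "z \<in> period_lattice T"
proof -
  have q: "0 < exp (- T)" "exp (- T) < 1" using T by auto
  have pow: "of_real (exp (- T) ^ n) = exp (- of_nat n * of_real T :: complex)" for n
    by (metis exp_of_nat_mult exp_of_real mult_minus_left mult_minus_right of_real_minus of_real_power)
  from assms consider "q_poch (exp (- T)) (exp z) = 0" | "q_poch (exp (- T)) (exp (- z - of_real T)) = 0"
    by (auto simp: lattice_fn_def)
  then show ?thesis
  proof cases
    case 1
    then obtain n where "of_real (exp (- T) ^ n) * exp z = 1"
      using q_poch_eq_0_imp[OF q] by blast
    then have "exp (- of_nat n * of_real T + z) = 1"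
      by (simp only: pow exp_add)
    then obtain k where "- of_nat n * of_real T + z = of_int k * (2 * pi * \<i>)"
      using exp_eq_1_imp by blast
    then have "z = of_int k * (2 * pi * \<i>) + of_int (int n) * of_real T"
      by (simp add: algebra_simps)
    then show ?thesis using period_latticeI by metis
  next
    case 2
    then obtain n where "of_real (exp (- T) ^ n) * exp (- z - of_real T) = 1"
      using q_poch_eq_0_imp[OF q] by blast
    then have "exp (- of_nat n * of_real T + (- z - of_real T)) = 1"
      by (simp only: pow exp_add)
    then obtain k where "- of_nat n * of_real T + (- z - of_real T) = of_int k * (2 * pi * \<i>)"
      using exp_eq_1_imp by blast
    then have "z = of_int (- k) * (2 * pi * \<i>) + of_int (- int (Suc n)) * of_real T"
      by (auto simp: complex_eq_iff algebra_simps)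
    then show ?thesis using period_latticeI by metis
  qed
qed

text \<open>By the product rule the derivative is minus the cofactor of 1 - e^z at 0. There both
  remaining products are evaluated at e^(-T), inside the unit disc, where they have no
  zeros.\<close>

lemma lattice_fn_deriv_0: "deriv (lattice_fn T) 0 \<noteq> 0"
proof -
  define R where "R = (\<lambda>z. q_poch (exp (- T)) (exp (z - of_real T)) * q_poch (exp (- T)) (exp (- z - of_real T)))"
  have "q_poch (exp (- T)) holomorphic_on UNIV"
    using T by (intro q_poch_holomorphic) auto
  then have "(q_poch (exp (- T)) \<circ> g) holomorphic_on UNIV" if "g holomorphic_on UNIV" for g
    using that by (meson holomorphic_on_compose_gen subset_UNIV image_subset_iff UNIV_I)
  note comp = this[unfolded o_def]
  have "R holomorphic_on UNIV"
    unfolding R_def by (intro holomorphic_on_mult comp holomorphic_intros)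
  then have R: "(R has_field_derivative deriv R 0) (at 0)"
    by (rule holomorphic_derivI) auto
  have "((\<lambda>z. (1 - exp z) * R z) has_field_derivative - R 0) (at 0)"
    by (rule derivative_eq_intros R refl)+ simp
  moreover have "lattice_fn T = (\<lambda>z. (1 - exp z) * R z)"
    by (simp add: fun_eq_iff lattice_fn_factor R_def)
  moreover have "R 0 \<noteq> 0"
  proof -
    have "norm (exp (- of_real T :: complex)) < 1" using T by (simp add: norm_exp_eq_Re)
    then show ?thesis using T q_poch_neq_0[of "exp (- T)"] by (simp add: R_def)
  qed
  ultimately show ?thesis by (simp add: DERIV_imp_deriv)
qed

end

text \<open>Moving a zero by -T needs only the shift rule; moving it by +T divides by the
  multiplier, hence the condition on \<open>e\<close>. The form is general because it serves
  \<open>lattice_fn\<close>, an indicator function of its simple zeros, and arbitrary theta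
  functions.\<close>

lemma zero_on_period_lattice:
  assumes per: "\<And>z. f (z + 2 * pi * \<i>) = f z"
    and shift: "\<And>z. f (z - of_real T) = e z * f z" and e: "\<And>z. e z \<noteq> (0::complex)"
    and f: "f p = 0" and w: "w \<in> period_lattice T"
  shows "f (p + w) = (0::complex)"
proof -
  have 1: "f (z + of_int k * (2 * pi * \<i>)) = f z" for z k
  proof (induction k rule: int_induct[where k = 0])
    case (step1 i)
    then show ?case using per[of "z + of_int i * (2 * pi * \<i>)"] by (simp add: algebra_simps)
  next
    case (step2 i)
    then show ?case using per[of "z + of_int (i - 1) * (2 * pi * \<i>)"] by (simp add: algebra_simps)
  qed simp
  have 2: "f (p + of_int l * of_real T) = 0" for l
  proof (induction l rule: int_induct[where k = 0])
    case base then show ?case using f by simp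
  next
    case (step1 i)
    then show ?case using shift[of "p + of_int (i + 1) * of_real T"] e by (simp add: algebra_simps)
  next
    case (step2 i)
    then show ?case using shift[of "p + of_int i * of_real T"] by (simp add: algebra_simps)
  qed
  obtain k l where "w = of_int k * (2 * pi * \<i>) + of_int l * of_real T"
    using w by (auto simp: period_lattice_def)
  then show ?thesis using 1[of "p + of_int l * of_real T" k] 2[of l] by (simp add: add_ac)
qed

lemma lattice_fn_lattice:
  assumes "T > 0" "w \<in> period_lattice T"
  shows "lattice_fn T w = 0" "deriv (lattice_fn T) w \<noteq> 0"
proof -
  note hol = lattice_fn_holomorphic[OF assms(1)]
  have D: "(lattice_fn T has_field_derivative deriv (lattice_fn T) z) (at z)" for z
    using hol by (rule holomorphic_derivI) auto
  have "lattice_fn T 0 = 0"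
    using assms(1) by (simp add: lattice_fn_factor)
  note zero = zero_on_period_lattice[where f = "lattice_fn T" and e = "\<lambda>z. - exp (- z)",
      OF lattice_fn_periodic[OF assms(1)] lattice_fn_shift[OF assms(1)] _ this]
  show 0: "lattice_fn T w = 0" using zero[OF _ assms(2)] by simp
  have per: "deriv (lattice_fn T) (z + 2 * pi * \<i>) = deriv (lattice_fn T) z" for z
  proof -
    have "((\<lambda>z. lattice_fn T (z + 2 * pi * \<i>)) has_field_derivative deriv (lattice_fn T) (z + 2 * pi * \<i>)) (at z)"
      using DERIV_shift[of "lattice_fn T" _ z "2 * pi * \<i>"] D by blast
    then have "(lattice_fn T has_field_derivative deriv (lattice_fn T) (z + 2 * pi * \<i>)) (at z)"
      by (simp only: lattice_fn_periodic[OF assms(1)])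
    then show ?thesis using D DERIV_unique by blast
  qed
  \<comment> \<open>Differentiating the shift rule produces an extra term containing
    \<open>lattice_fn\<close> itself, so the derivative obeys the same rule only at zeros.\<close>
  have shift: "deriv (lattice_fn T) (z - of_real T) = - exp (- z) * deriv (lattice_fn T) z"
    if "lattice_fn T z = 0" for z
  proof -
    have "((\<lambda>z. lattice_fn T (z + - of_real T)) has_field_derivative deriv (lattice_fn T) (z + - of_real T)) (at z)"
      using DERIV_shift[of "lattice_fn T" _ z "- of_real T"] D by blast
    then have "((\<lambda>z. - exp (- z) * lattice_fn T z) has_field_derivative deriv (lattice_fn T) (z - of_real T)) (at z)"
      by (simp add: lattice_fn_shift[OF assms(1)])
    moreover have "((\<lambda>z. - exp (- z) * lattice_fn T z) has_field_derivative - exp (- z) * deriv (lattice_fn T) z) (at z)"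
      by (rule derivative_eq_intros D refl)+ (simp add: that)
    ultimately show ?thesis using DERIV_unique by blast
  qed
  \<comment> \<open>The zeros of \<open>f\<close> are the simple zeros of \<^term>\<open>lattice_fn T\<close>, so simplicity at \<open>0\<close> spreads
    over the lattice.\<close>
  define f where "f z = (if lattice_fn T z = 0 \<and> deriv (lattice_fn T) z \<noteq> 0 then 0 else 1::complex)" for z
  have "f (0 + w) = 0"
  proof (rule zero_on_period_lattice[where e = "\<lambda>z. 1"])
    show "f (z + 2 * pi * \<i>) = f z" for z
      by (simp only: f_def per lattice_fn_periodic[OF assms(1)])
    show "f (z - of_real T) = 1 * f z" for z
      using shift[of z] by (auto simp: f_def lattice_fn_shift[OF assms(1)])
    show "f 0 = 0"
      using \<open>lattice_fn T 0 = 0\<close> lattice_fn_deriv_0[OF assms(1)] by (simp add: f_def)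
  qed (use assms in auto)
  then show "deriv (lattice_fn T) w \<noteq> 0" by (simp add: f_def split: if_splits)
qed

section \<open>Quasi-periodic entire functions with prescribed zeros\<close>

lemma holomorphic_on_translate:
  assumes "f holomorphic_on UNIV"
  shows "(\<lambda>z. f (z + c)) holomorphic_on UNIV"
proof -
  have "(\<lambda>z. z + c) holomorphic_on UNIV" by (intro holomorphic_intros)
  from holomorphic_on_compose_gen[OF this assms] show ?thesis by (simp add: o_def)
qed

text \<open>At a zero \<open>a\<close> of \<open>s\<close>, both functions are divisible by z - a,
  and the quotient is that of the two difference quotients \<open>F\<close> and \<open>S\<close>,
  which are entire with \<open>S a\<close> equal to the nonzero derivative of \<open>s\<close>. The
  value given to \<open>g\<close> at \<open>a\<close> is thus the one from l'Hopital's rule.\<close>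

lemma entire_divide_simple_zeros:
  assumes f: "f holomorphic_on UNIV" and s: "s holomorphic_on UNIV"
    and simple: "\<And>z. s z = 0 \<Longrightarrow> f z = 0 \<and> deriv s z \<noteq> 0"
  shows "\<exists>g. g holomorphic_on UNIV \<and> (\<forall>z. f z = g z * s z)"
proof -
  define g where "g z = (if s z = 0 then deriv f z / deriv s z else f z / s z)" for z
  have nz: "eventually (\<lambda>z. u z \<noteq> 0) (nhds a)" if "u holomorphic_on UNIV" "u a \<noteq> 0" for u and a :: complex
  proof -
    have "isCont u a"
      using holomorphic_on_imp_continuous_on[OF that(1)] by (simp add: continuous_on_eq_continuous_at)
    then have "eventually (\<lambda>z. u z \<noteq> 0) (at a)"
      using that(2) by (simp add: isCont_def tendsto_imp_eventually_ne)
    then show ?thesis using that(2) by (auto simp: eventually_at_filter elim!: eventually_mono)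
  qed
  have transf: "g field_differentiable at a"
    if "u field_differentiable at a" "eventually (\<lambda>z. u z = g z) (nhds a)" for u a
    using that DERIV_cong_ev unfolding field_differentiable_def by metis
  have "g field_differentiable at a" for a
  proof (cases "s a = 0")
    case False
    have "(\<lambda>z. f z / s z) field_differentiable at a"
      using f s False by (intro field_differentiable_divide) (auto simp: holomorphic_on_def)
    moreover have "eventually (\<lambda>z. f z / s z = g z) (nhds a)"
      using nz[OF s False] by (auto elim!: eventually_mono simp: g_def)
    ultimately show ?thesis by (rule transf)
  next
    case True
    define F where "F = (\<lambda>z. if z = a then deriv f a else (f z - f a) / (z - a))"
    define S where "S = (\<lambda>z. if z = a then deriv s a else (s z - s a) / (z - a))"
    have F: "F holomorphic_on UNIV" and S: "S holomorphic_on UNIV"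
      unfolding F_def S_def using f s by (auto intro!: pole_lemma_open)
    have Sa: "S a \<noteq> 0" using simple True by (simp add: S_def)
    have "(\<lambda>z. F z / S z) field_differentiable at a"
      using F S Sa by (intro field_differentiable_divide) (auto simp: holomorphic_on_def)
    moreover have "eventually (\<lambda>z. F z / S z = g z) (nhds a)"
      using nz[OF S Sa]
    proof eventually_elim
      case (elim z)
      then show ?case using simple True by (auto simp: g_def F_def S_def)
    qed
    ultimately show ?thesis by (rule transf)
  qed
  then have "g holomorphic_on UNIV"
    by (simp add: holomorphic_on_def)
  moreover have "f z = g z * s z" for z
    using simple by (auto simp: g_def)
  ultimately show ?thesis by blast
qed

text \<open>A real exponential factor normalises the multiplier to modulus 1. The modulus of the
  resulting entire function is doubly periodic, so Liouville makes it constant and \<open>g\<close>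
  is a multiple of e^(az); the period 2 pi i then forces \<open>a\<close> to be an integer.\<close>

lemma quasi_periodic_multiplier:
  assumes g: "g holomorphic_on UNIV" and T: "T > 0" and A: "A \<noteq> 0"
    and per: "\<And>z. g (z + 2 * pi * \<i>) = g z"
    and shift: "\<And>z. g (z - of_real T) = A * g z"
    and nz: "g y \<noteq> 0"
  shows "\<exists>a::int. A = of_real (exp (- (of_int a * T)))"
proof -
  \<comment> \<open>Chosen so that \<open>A\<close> has modulus e^(-aT). The phase of
    \<open>A\<close> is not corrected here, since boundedness concerns only the modulus.\<close>
  define a where "a = - ln (norm A) / T"
  define u where "u = (\<lambda>z. g z * exp (- of_real a * z))"
  have normA: "norm A = exp (- (a * T))"
    using T A by (simp add: a_def exp_minus)
  have u_hol: "u holomorphic_on UNIV"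
    unfolding u_def using g by (intro holomorphic_intros)
  have n1: "norm (u (z + 2 * pi * \<i>)) = norm (u z)" for z
    using per[of z] by (simp add: u_def norm_mult norm_exp_eq_Re)
  have n2: "norm (u (z - of_real T)) = norm (u z)" for z
    by (simp add: u_def norm_mult shift norm_exp_eq_Re normA mult_exp_exp algebra_simps)
  have m1: "norm (u (z + of_int k * (2 * pi * \<i>))) = norm (u z)" for z k
  proof (induction k rule: int_induct[where k = 0])
    case (step1 i)
    then show ?case using n1[of "z + of_int i * (2 * pi * \<i>)"] by (simp add: algebra_simps)
  next
    case (step2 i)
    then show ?case using n1[of "z + of_int (i - 1) * (2 * pi * \<i>)"] by (simp add: algebra_simps)
  qed simp
  have m2: "norm (u (z + of_int k * of_real T)) = norm (u z)" for z k
  proof (induction k rule: int_induct[where k = 0])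
    case (step1 i)
    then show ?case using n2[of "z + of_int (i + 1) * of_real T"] by (simp add: algebra_simps)
  next
    case (step2 i)
    then show ?case using n2[of "z + of_int i * of_real T"] by (simp add: algebra_simps)
  qed simp
  have "bounded (u ` cbox 0 (Complex T (2 * pi)))"
    using holomorphic_on_imp_continuous_on[OF u_hol]
    by (intro compact_imp_bounded compact_continuous_image compact_cbox) (auto intro: continuous_on_subset)
  then obtain B where B: "\<And>z. z \<in> cbox 0 (Complex T (2 * pi)) \<Longrightarrow> norm (u z) \<le> B"
    by (auto simp: bounded_iff)
  have "norm (u z) \<le> B" for z
  proof -
    \<comment> \<open>Subtracting integer parts in both period directions brings \<open>z\<close>
      into the fundamental rectangle.\<close>
    define k where "k = - \<lfloor>Im z / (2 * pi)\<rfloor>"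
    define l where "l = - \<lfloor>Re z / T\<rfloor>"
    define w where "w = z + of_int k * (2 * pi * \<i>) + of_int l * of_real T"
    have "Re w = T * frac (Re z / T)" "Im w = 2 * pi * frac (Im z / (2 * pi))"
      using T by (simp_all add: w_def k_def l_def frac_def algebra_simps)
    then have "w \<in> cbox 0 (Complex T (2 * pi))"
      using T frac_lt_1[of "Re z / T"] frac_ge_0[of "Re z / T"]
        frac_lt_1[of "Im z / (2 * pi)"] frac_ge_0[of "Im z / (2 * pi)"]
      by (simp add: in_cbox_complex_iff)
    then show ?thesis using B[of w] m1 m2 by (simp add: w_def)
  qed
  then have "bounded (range u)"
    by (auto simp: bounded_iff)
  then have "u constant_on UNIV"
    using u_hol Liouville_theorem by blast
  then obtain K where K: "\<And>z. u z = K"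
    by (auto simp: constant_on_def)
  have gK: "g z = K * exp (of_real a * z)" for z
    using K[of z] by (simp add: u_def exp_minus field_simps)
  with nz have K0: "K \<noteq> 0" by auto
  have "exp (of_real a * (2 * pi * \<i>)) = (1::complex)"
    using per[of 0] K0 by (simp add: gK)
  then obtain k where "of_real a * (2 * pi * \<i>) = of_int k * (2 * pi * \<i> :: complex)"
    using exp_eq_1_imp by blast
  then have "complex_of_real a = of_int k" by simp
  then have ak: "a = of_int k"
    by (metis of_real_eq_iff of_real_of_int_eq)
  have "A = exp (- of_real (a * T))"
    using shift[of 0] K0 by (simp add: gK)
  then show ?thesis
    by (metis ak exp_of_real of_real_minus)
qed

text \<open>Abel's theorem for theta functions of degree \<open>card P\<close>.\<close>

lemma quasi_periodic_zeros_sum: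
  assumes "finite P" and T: "T > 0" and "A \<noteq> 0" and "f holomorphic_on UNIV"
    and "\<And>z. f (z + 2 * pi * \<i>) = f z"
    and "\<And>z. f (z - of_real T) = A * exp (- of_nat (card P) * z) * f z"
    and "\<And>p. p \<in> P \<Longrightarrow> f p = 0"
    and "\<And>p p'. p \<in> P \<Longrightarrow> p' \<in> P \<Longrightarrow> p - p' \<in> period_lattice T \<Longrightarrow> p = p'"
    and "f y \<noteq> 0"
  shows "\<exists>a::int. (-1) ^ card P * A * exp (- (\<Sum>p\<in>P. p)) = of_real (exp (- (of_int a * T)))"
  using assms(1,3-)
proof (induction P arbitrary: A f rule: finite_induct)
  case empty
  then show ?case using quasi_periodic_multiplier[of f T A y] T by simp
next
  case (insert p P)
  note hyps = insert.prems
  define s where "s = (\<lambda>z. lattice_fn T (z - p))"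
  have s_hol: "s holomorphic_on UNIV"
    using holomorphic_on_translate[OF lattice_fn_holomorphic[OF T], of "- p"] by (simp add: s_def)
  have s_zero: "z - p \<in> period_lattice T" if "s z = 0" for z
    using that lattice_fn_eq_0_imp[OF T] by (simp add: s_def)
  have s_deriv: "deriv s z = deriv (lattice_fn T) (z - p)" for z
  proof -
    have "(lattice_fn T has_field_derivative deriv (lattice_fn T) (z + - p)) (at (z + - p))"
      using lattice_fn_holomorphic[OF T] by (rule holomorphic_derivI) auto
    then show ?thesis
      using DERIV_shift[of "lattice_fn T" _ z "- p"] by (auto simp: s_def intro: DERIV_imp_deriv)
  qed
  have s_per: "s (z + 2 * pi * \<i>) = s z" for z
    using lattice_fn_periodic[OF T, of "z - p"] by (simp add: s_def algebra_simps)
  have s_shift: "s (z - of_real T) = - exp (p - z) * s z" for z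
    using lattice_fn_shift[OF T, of "z - p"] by (simp add: s_def algebra_simps)
  \<comment> \<open>The zeros of \<open>s\<close> are the translates of \<open>p\<close> by the
    lattice, and the zero of \<open>f\<close> at \<open>p\<close> propagates to all of them.\<close>
  have "f z = 0 \<and> deriv s z \<noteq> 0" if "s z = 0" for z
    using zero_on_period_lattice[of f T "\<lambda>z. A * exp (- of_nat (card (insert p P)) * z)" p "z - p"]
      s_zero[OF that] lattice_fn_lattice(2)[OF T s_zero[OF that]] hyps by (simp add: s_deriv)
  then obtain g where g: "g holomorphic_on UNIV" and fg: "\<And>z. f z = g z * s z"
    using entire_divide_simple_zeros[OF hyps(2) s_hol] by blast
  have s_simple: "deriv s z \<noteq> 0" if "s z = 0" for z
    using lattice_fn_lattice(2)[OF T s_zero[OF that]] by (simp add: s_deriv)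
  \<comment> \<open>Functional equations of \<open>g\<close> are obtained from those of
    \<open>f\<close> by cancelling \<open>s\<close>. At a zero of \<open>s\<close> this works
    because that zero is isolated and both sides are continuous.\<close>
  have cancel: "u z = v z" if uv: "u holomorphic_on UNIV" "v holomorphic_on UNIV" "\<And>z. u z * s z = v z * s z" for u v z
  proof (cases "s z = 0")
    case False
    with uv(3)[of z] show ?thesis by simp
  next
    case True
    have "(s has_field_derivative deriv s z) (at z)"
      using s_hol by (rule holomorphic_derivI) auto
    then have "eventually (\<lambda>w. (s w - s z) / (w - z) \<noteq> 0) (at z)"
      unfolding has_field_derivative_iff by (rule tendsto_imp_eventually_ne) (rule s_simple[OF True])
    then have ev: "eventually (\<lambda>w. s w \<noteq> 0) (at z)"
      by eventually_elim (use True in auto)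
    have "isCont (\<lambda>w. u w - v w) z"
      using holomorphic_on_imp_continuous_on[OF holomorphic_on_diff[OF uv(1,2)]] by (simp add: continuous_on_eq_continuous_at)
    moreover have "((\<lambda>w. u w - v w) \<longlongrightarrow> 0) (at z)"
      by (rule tendsto_eventually) (use ev uv(3) in \<open>auto elim!: eventually_mono\<close>)
    ultimately show ?thesis
      using LIM_unique[of "\<lambda>w. u w - v w" "u z - v z" z 0] by (simp add: isCont_def)
  qed
  note shift_hol = holomorphic_on_translate[OF g]
  have g_per: "g (z + 2 * pi * \<i>) = g z" for z
  proof (rule cancel[OF shift_hol g])
    show "g (z + 2 * pi * \<i>) * s z = g z * s z" for z
      using hyps(3)[of z] by (simp only: fg s_per)
  qed
  \<comment> \<open>Dividing by the multiplier -e^(p-z) of \<open>s\<close> removes one e^(-z) and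
    leaves the constant -e^(-p). Hence the left-hand side of the conclusion is the same number for
    \<open>f\<close> with \<open>insert p P\<close> and for \<open>g\<close> with
    \<open>P\<close>.\<close>
  define A' where "A' = - A * exp (- p)"
  have g_shift: "g (z - of_real T) = A' * exp (- of_nat (card P) * z) * g z" for z
  proof -
    have "g (z + - of_real T) = A' * exp (- of_nat (card P) * z) * g z"
    proof (rule cancel[OF shift_hol])
      show "(\<lambda>z. A' * exp (- of_nat (card P) * z) * g z) holomorphic_on UNIV"
        by (intro holomorphic_intros g)
      fix z
      have "g (z - of_real T) * (- exp (p - z) * s z) = A * exp (- of_nat (Suc (card P)) * z) * (g z * s z)"
        using hyps(4)[of z] insert.hyps by (simp add: fg s_shift)
      moreover have "exp (- of_nat (Suc (card P)) * z) = exp (- z) * exp (- of_nat (card P) * z)"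
        by (simp add: mult_exp_exp algebra_simps)
      moreover have "exp (p - z) = exp p * exp (- z)"
        by (simp add: mult_exp_exp)
      ultimately have "g (z - of_real T) * (- (exp p * exp (- z)) * s z) =
          A * (exp (- z) * exp (- of_nat (card P) * z)) * (g z * s z)"
        by (simp only:)
      then have "exp (- z) * (- (exp p * (g (z - of_real T) * s z))) =
          exp (- z) * (A * exp (- of_nat (card P) * z) * g z * s z)"
        by (simp only: mult_ac mult_minus_left mult_minus_right)
      then have "- (exp p * (g (z - of_real T) * s z)) = A * exp (- of_nat (card P) * z) * g z * s z"
        by (simp only: mult_left_cancel exp_not_eq_zero not_False_eq_True)
      then have "- exp (- p) * (- (exp p * (g (z - of_real T) * s z))) =
          - exp (- p) * (A * exp (- of_nat (card P) * z) * g z * s z)"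
        by (simp only:)
      moreover have "- exp (- p) * (- (exp p * x)) = x" for x
        by (simp add: exp_minus)
      ultimately have "g (z - of_real T) * s z = - exp (- p) * (A * exp (- of_nat (card P) * z) * g z * s z)"
        by (simp only:)
      then show "g (z + - of_real T) * s z = A' * exp (- of_nat (card P) * z) * g z * s z"
        by (simp add: A'_def mult_ac)
    qed
    then show ?thesis by simp
  qed
  \<comment> \<open>Incongruence to \<open>p\<close> keeps \<open>s\<close> away from 0 at the
    remaining points, so the zeros of \<open>f\<close> there pass to \<open>g\<close>.\<close>
  have "g p' = 0" if "p' \<in> P" for p'
  proof -
    have "p' = p" if "s p' = 0"
      using hyps(6)[of p' p] s_zero[OF that] \<open>p' \<in> P\<close> by simp
    with that insert.hyps have "s p' \<noteq> 0" by auto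
    then show ?thesis using fg[of p'] hyps(5) that by simp
  qed
  moreover have "g y \<noteq> 0" using fg hyps(7) by auto
  ultimately have "\<exists>a::int. (-1) ^ card P * A' * exp (- (\<Sum>p\<in>P. p)) = of_real (exp (- (of_int a * T)))"
    using insert.IH[of A' g] g g_per g_shift hyps by (simp add: A'_def)
  then show ?case
    using insert.hyps by (simp add: A'_def exp_add exp_minus exp_diff field_simps)
qed

section \<open>The sampled and periodized Gaussian\<close>

definition theta :: "real \<Rightarrow> complex \<Rightarrow> complex" where
  "theta a z = (\<Sum>\<^sub>\<infinity>p\<in>UNIV. exp (of_int p * z - of_real (a * (of_int p)\<^sup>2)))"

text \<open>The nonnegative half of the bilateral series as a power series in w = e^z. Splitting
  \<open>theta\<close> into such halves reduces its holomorphy and convergence to power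
  series.\<close>

definition theta_half :: "real \<Rightarrow> complex \<Rightarrow> complex" where
  "theta_half a w = (\<Sum>n. of_real (exp (- (a * (real n)\<^sup>2))) * w ^ n)"

context
  fixes a :: real
  assumes a: "a > 0"
begin

lemma summable_theta_half: "summable (\<lambda>n. complex_of_real (exp (- (a * (real n)\<^sup>2))) * w ^ n)"
proof (rule summable_power_series_ratio_0[where r = "\<lambda>n. exp (- a) ^ n"])
  fix n
  have "a * real n \<le> a * (2 * real n + 1)" using a by (intro mult_left_mono) auto
  then have "- (a * (real (Suc n))\<^sup>2) \<le> of_nat n * (- a) + - (a * (real n)\<^sup>2)"
    by (simp add: power2_eq_square algebra_simps)
  then have "exp (- (a * (real (Suc n))\<^sup>2)) \<le> exp (of_nat n * (- a)) * exp (- (a * (real n)\<^sup>2))"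
    unfolding mult_exp_exp by simp
  then show "norm (complex_of_real (exp (- (a * (real (Suc n))\<^sup>2))))
      \<le> exp (- a) ^ n * norm (complex_of_real (exp (- (a * (real n)\<^sup>2))))"
    unfolding exp_of_nat_mult norm_of_real by simp
next
  show "(\<lambda>n. exp (- a) ^ n) \<longlonglongrightarrow> 0" using a by (intro LIMSEQ_realpow_zero) auto
qed

lemma theta_half_holomorphic: "theta_half a holomorphic_on UNIV"
  using entire_power_series[OF summable_theta_half] by (simp add: theta_half_def[abs_def])

lemma theta_half_has_sum: "((\<lambda>n. complex_of_real (exp (- (a * (real n)\<^sup>2))) * w ^ n) has_sum theta_half a w) UNIV"
proof (rule norm_summable_imp_has_sum)
  \<comment> \<open>Absolute convergence at \<open>w\<close> follows from convergence at a point of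
    larger modulus; |w| + 1 serves.\<close>
  have "norm w < norm (of_real (norm w + 1) :: complex)"
    by (simp only: norm_of_real)
  then show "summable (\<lambda>n. norm (complex_of_real (exp (- (a * (real n)\<^sup>2))) * w ^ n))"
    by (rule powser_insidea[OF summable_theta_half])
  show "(\<lambda>n. complex_of_real (exp (- (a * (real n)\<^sup>2))) * w ^ n) sums theta_half a w"
    unfolding theta_half_def by (rule summable_sums[OF summable_theta_half])
qed

text \<open>The negative indices contribute the half series in e^(-z); the subtracted 1 is the term
  p = 0, which both halves contain.\<close>

lemma theta_has_sum:
  "((\<lambda>p. exp (of_int p * z - of_real (a * (of_int p)\<^sup>2))) has_sum (theta_half a (exp z) + (theta_half a (exp (- z)) - 1)))
     (UNIV :: int set)"
proof -
  define t :: "int \<Rightarrow> complex" where "t = (\<lambda>p. exp (of_int p * z - of_real (a * (of_int p)\<^sup>2)))"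
  have t_nat: "complex_of_real (exp (- (a * (real n)\<^sup>2))) * exp w ^ n = exp (of_nat n * w - of_real (a * (real n)\<^sup>2))" for w n
    by (simp add: exp_diff exp_of_nat_mult exp_of_nat2_mult exp_minus field_simps exp_of_real[symmetric])
  have "((t \<circ> int) has_sum theta_half a (exp z)) UNIV"
    using theta_half_has_sum[of "exp z"] unfolding t_nat by (simp add: t_def o_def)
  then have pos: "(t has_sum theta_half a (exp z)) (int ` UNIV)"
    by (subst has_sum_reindex) auto
  have "((\<lambda>n. exp (of_nat n * (- z) - of_real (a * (real n)\<^sup>2))) has_sum (theta_half a (exp (- z)) - 1)) (UNIV - {0})"
    using has_sum_Diff[OF theta_half_has_sum[of "exp (- z)"] has_sum_finite[of "{0}"]]
    unfolding t_nat by simp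
  then have "((t \<circ> (\<lambda>n. - int n)) has_sum (theta_half a (exp (- z)) - 1)) (UNIV - {0})"
    by (simp add: t_def o_def)
  then have neg: "(t has_sum (theta_half a (exp (- z)) - 1)) ((\<lambda>n. - int n) ` (UNIV - {0}))"
    by (subst has_sum_reindex) (auto simp: inj_on_def)
  have "int ` UNIV \<inter> (\<lambda>n. - int n) ` (UNIV - {0}) = {}"
    by auto
  note un = has_sum_Un_disjoint[OF pos neg this]
  moreover have "p \<in> int ` UNIV \<union> (\<lambda>n. - int n) ` (UNIV - {0})" for p
    by (cases p rule: int_cases2) (auto simp: image_iff)
  then have "int ` UNIV \<union> (\<lambda>n. - int n) ` (UNIV - {0}) = UNIV"
    by (rule UNIV_eq_I[symmetric])
  ultimately show ?thesis by (simp add: t_def)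
qed

lemma theta_eq: "theta a z = theta_half a (exp z) + (theta_half a (exp (- z)) - 1)"
  unfolding theta_def by (rule infsumI[OF theta_has_sum])

lemma theta_holomorphic: "theta a holomorphic_on UNIV"
proof -
  have comp: "(\<lambda>z. theta_half a (g z)) holomorphic_on UNIV" if "g holomorphic_on UNIV" for g
    using holomorphic_on_compose_gen[OF that theta_half_holomorphic] by (simp add: o_def)
  show ?thesis
    unfolding theta_eq[abs_def] by (intro holomorphic_on_add holomorphic_on_diff comp holomorphic_intros)
qed

lemma theta_cong: "exp z = exp z' \<Longrightarrow> theta a z = theta a z'"
  by (simp add: theta_eq exp_minus)

text \<open>Replacing p by p + 1 in the series and expanding the square gives (p+1)z - a(p+1)^2 = (z
  - a) + p(z - 2a) - a p^2.\<close>

lemma theta_shift: "theta a (z - of_real (2 * a)) = exp (of_real a - z) * theta a z"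
proof -
  have "theta a z = (\<Sum>\<^sub>\<infinity>p\<in>UNIV. exp (of_int (p + 1) * z - of_real (a * (of_int (p + 1))\<^sup>2)))"
    unfolding theta_def
    by (rule infsum_reindex_bij_betw[symmetric]) (rule bij_betwI[where g = "\<lambda>p. p - 1"], auto)
  also have "\<dots> = (\<Sum>\<^sub>\<infinity>p\<in>UNIV. exp (z - of_real a) *
      exp (of_int p * (z - of_real (2 * a)) - of_real (a * (of_int p)\<^sup>2)))"
    by (simp add: mult_exp_exp power2_eq_square algebra_simps)
  also have "\<dots> = exp (z - of_real a) * theta a (z - of_real (2 * a))"
    by (simp only: infsum_cmult_right' theta_def)
  finally show ?thesis by (simp add: mult_exp_exp flip: mult.assoc)
qed

text \<open>On the real axis every term is a positive real, so \<open>theta\<close> has no real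
  zeros. This makes all entries of the sampled Gaussian nonzero and lets \<open>c\<close> be
  recovered at the end of the one-coordinate argument.\<close>

lemma theta_of_real:
  "theta a (of_real x) = of_real (\<Sum>\<^sub>\<infinity>p\<in>UNIV. exp (of_int p * x - a * (of_int p)\<^sup>2))"
  and theta_real_pos: "(\<Sum>\<^sub>\<infinity>p\<in>UNIV. exp (of_int p * x - a * (of_int p)\<^sup>2)) > 0"
proof -
  have real_term: "exp (of_int p * of_real x - of_real (a * (of_int p)\<^sup>2)) =
      complex_of_real (exp (of_int p * x - a * (of_int p)\<^sup>2))" for p :: int
    by (simp add: exp_of_real[symmetric])
  have "((\<lambda>p. exp (of_int p * x - a * (of_int p)\<^sup>2)) has_sum
      Re (theta_half a (exp (of_real x)) + (theta_half a (exp (- of_real x)) - 1))) (UNIV :: int set)"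
    using has_sum_Re[OF theta_has_sum[of "of_real x"]] by (simp only: real_term Re_complex_of_real)
  then have sum: "(\<lambda>p. exp (of_int p * x - a * (of_int p)\<^sup>2)) summable_on (UNIV :: int set)"
    by (auto simp: summable_on_def)
  show "theta a (of_real x) = of_real (\<Sum>\<^sub>\<infinity>p\<in>UNIV. exp (of_int p * x - a * (of_int p)\<^sup>2))"
    unfolding theta_def real_term by (rule infsumI[OF has_sum_of_real[OF has_sum_infsum[OF sum]]])
  have "0 < (\<Sum>p\<in>{0::int}. exp (of_int p * x - a * (of_int p)\<^sup>2))" by simp
  also have "\<dots> \<le> (\<Sum>\<^sub>\<infinity>p\<in>UNIV. exp (of_int p * x - a * (of_int p)\<^sup>2))"
    by (intro finite_sum_le_infsum sum) auto
  finally show "(\<Sum>\<^sub>\<infinity>p\<in>UNIV. exp (of_int p * x - a * (of_int p)\<^sup>2)) > 0" .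
qed

end

text \<open>Expanding (k + pN)^2 / N = k^2 / N + 2pk + p^2 N separates the Gaussian at k from a
  theta series with parameter pi l N at the real point -2 pi l k.\<close>

lemma sampled_gaussian_theta:
  assumes N: "N > 0" and l: "l > 0" and h: "is_sampled_gaussian N l h"
  shows "\<exists>\<kappa>. \<kappa> \<noteq> 0 \<and> (\<forall>k. h k = \<kappa> * of_real (exp (- (pi * l * (of_int k)\<^sup>2 / real N))) *
      theta (pi * l * real N) (of_real (2 * pi * l * of_int (- k))))"
proof -
  have split: "(\<Sum>\<^sub>\<infinity>p\<in>UNIV. exp (- pi * l * (of_int (k + p * int N))\<^sup>2 / real N)) =
      exp (- (pi * l * (of_int k)\<^sup>2 / real N)) *
      (\<Sum>\<^sub>\<infinity>p\<in>UNIV. exp (of_int p * (2 * pi * l * of_int (- k)) - pi * l * real N * (of_int p)\<^sup>2))" for k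
  proof -
    have "- pi * l * (of_int (k + p * int N))\<^sup>2 / real N =
      - (pi * l * (of_int k)\<^sup>2 / real N) + (of_int p * (2 * pi * l * of_int (- k)) - pi * l * real N * (of_int p)\<^sup>2)" for p
      using N by (simp add: power2_eq_square field_simps)
    then show ?thesis by (simp only: exp_add infsum_cmult_right')
  qed
  have pos: "pi * l * real N > 0" using N l by simp
  obtain \<kappa> where \<kappa>: "\<kappa> \<noteq> 0" and hk: "\<And>k. h k = \<kappa> *
      of_real (\<Sum>\<^sub>\<infinity>p\<in>UNIV. exp (- pi * l * (of_int (k + p * int N))\<^sup>2 / real N))"
    using h unfolding is_sampled_gaussian_def by metis
  have "h k = \<kappa> * of_real (exp (- (pi * l * (of_int k)\<^sup>2 / real N))) *
      theta (pi * l * real N) (of_real (2 * pi * l * of_int (- k)))" for k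
    unfolding hk theta_of_real[OF pos] split by (simp add: mult.assoc)
  with \<kappa> show ?thesis by blast
qed

lemma sampled_gaussian_nonzero:
  assumes "N > 0" "l > 0" "is_sampled_gaussian N l h"
  shows "h k \<noteq> 0"
proof -
  have "pi * l * real N > 0" using assms by simp
  from theta_real_pos[OF this] have "theta (pi * l * real N) (of_real x) \<noteq> 0" for x
    by (simp only: theta_of_real[OF \<open>pi * l * real N > 0\<close>] of_real_eq_0_iff) (metis less_irrefl)
  moreover obtain \<kappa> where "\<kappa> \<noteq> 0" "h k = \<kappa> * of_real (exp (- (pi * l * (of_int k)\<^sup>2 / real N))) *
      theta (pi * l * real N) (of_real (2 * pi * l * of_int (- k)))"
    using sampled_gaussian_theta[OF assms] by blast
  ultimately show ?thesis
    by (simp only: mult_eq_0_iff of_real_eq_0_iff exp_not_eq_zero) simp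
qed

lemma sampled_gaussian_periodic:
  assumes "is_sampled_gaussian N l h" "[k = k'] (mod int N)"
  shows "h k = h k'"
proof -
  obtain q where q: "k = k' + int N * q"
    using assms(2) by (metis cong_iff_lin cong_sym)
  have "(\<Sum>\<^sub>\<infinity>p\<in>UNIV. exp (- pi * l * (of_int (k' + (p + q) * int N))\<^sup>2 / real N)) =
      (\<Sum>\<^sub>\<infinity>p\<in>UNIV. exp (- pi * l * (of_int (k' + p * int N))\<^sup>2 / real N))"
    by (rule infsum_reindex_bij_betw) (rule bij_betwI[where g = "\<lambda>p. p - q"], auto)
  moreover have "k + p * int N = k' + (p + q) * int N" for p
    by (simp add: q algebra_simps)
  ultimately have "(\<Sum>\<^sub>\<infinity>p\<in>UNIV. exp (- pi * l * (of_int (k + p * int N))\<^sup>2 / real N)) =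
      (\<Sum>\<^sub>\<infinity>p\<in>UNIV. exp (- pi * l * (of_int (k' + p * int N))\<^sup>2 / real N))"
    by (simp only:)
  then show ?thesis using assms(1) unfolding is_sampled_gaussian_def by metis
qed

section \<open>One coordinate: the theta function attached to an orthogonal vector\<close>

lemma cis_2pi_div_eq_1_imp:
  assumes "cis (2 * pi * of_int k / real N) = 1" "N > 0"
  shows "\<exists>q. k = q * int N"
proof -
  obtain q where "\<i> * of_real (2 * pi * of_int k / real N) = of_int q * (2 * pi * \<i>)"
    using assms(1) exp_eq_1_imp unfolding cis_conv_exp by blast
  then have "2 * pi * (of_int k / real N) = 2 * pi * of_int q"
    by (simp add: complex_eq_iff)
  then have "of_int k / real N = of_int q"
    by (simp only: mult_cancel_left) simp
  then have "real_of_int k = of_int (q * int N)"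
    using assms(2) by (simp add: field_simps)
  then show ?thesis unfolding of_int_eq_iff ..
qed

lemma sum_roots_of_unity:
  fixes k m :: int
  assumes "k \<in> {0..<int N}" "m \<in> {0..<int N}"
  shows "(\<Sum>s<N. cis (2 * pi * real s * of_int (k - m) / real N)) = (if k = m then of_nat N else 0)"
proof (cases "k = m")
  case False
  have N: "real N > 0" using assms by auto
  define w where "w = cis (2 * pi * of_int (k - m) / real N)"
  have pow: "cis (2 * pi * real s * of_int (k - m) / real N) = w ^ s" for s
    by (simp add: w_def Complex.DeMoivre mult_ac)
  have "w \<noteq> 1"
  proof
    assume "w = 1"
    then obtain q where q: "k - m = q * int N"
      using cis_2pi_div_eq_1_imp[OF \<open>w = 1\<close>[unfolded w_def]] N by auto
    have "\<bar>k - m\<bar> < int N" using assms by auto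
    then have "\<bar>q\<bar> * int N < 1 * int N" by (simp add: q abs_mult)
    then have "q = 0" by (simp only: mult_less_cancel_right) auto
    with q False show False by simp
  qed
  moreover have "w ^ N = 1"
  proof -
    have "w ^ N = cis (2 * pi * of_int (k - m))" using N by (simp add: w_def Complex.DeMoivre)
    then show ?thesis using cis_multiple_2pi[of "of_int (k - m)"] by simp
  qed
  ultimately have "(\<Sum>s<N. w ^ s) = 0" by (simp add: geometric_sum)
  with False show ?thesis unfolding pow by simp
qed (simp add: cis_zero)

lemma sampled_gaussian_weyl_injective:
  fixes c :: "int \<Rightarrow> complex"
  assumes N: "N > 0" and l: "l > 0" and h: "is_sampled_gaussian N l h"
    and Q_sub: "Q \<subseteq> {0..<int N} \<times> {0..<int N}" and Q_card: "card Q = N"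
    and Q_sum: "odd N \<or> \<not> ([(\<Sum>q\<in>Q. fst q) = 0] (mod int N) \<and> [(\<Sum>q\<in>Q. snd q) = 0] (mod int N))"
    and zero: "\<And>r s. (r, s) \<in> Q \<Longrightarrow>
      (\<Sum>k\<in>{0..<int N}. c k * cnj (cis (2 * pi * of_int s * of_int (k - r) / real N) * h (k - r))) = 0"
    and m: "m \<in> {0..<int N}"
  shows "c m = 0"
proof -
  define a where "a = pi * l * real N"
  define T where "T = 2 * pi * l"
  have a: "a > 0" and T: "T > 0" and N0: "real N > 0" using N l by (auto simp: a_def T_def)
  obtain \<kappa> where \<kappa>: "\<kappa> \<noteq> 0" and hk: "\<And>k. h k = \<kappa> * of_real (exp (- (pi * l * (of_int k)\<^sup>2 / real N))) *
      theta a (of_real (T * of_int (- k)))"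
    using sampled_gaussian_theta[OF N l h] unfolding a_def T_def by blast
  \<comment> \<open>The bilateral series with \<open>c\<close> extended periodically, grouped by
    residues modulo \<open>N\<close>: the terms with index k + pN add up to one value of
    \<open>theta\<close>.\<close>
  define F where "F = (\<lambda>z. \<Sum>k\<in>{0..<int N}. c k *
      (exp (of_int k * z - of_real (pi * l * (of_int k)\<^sup>2 / real N)) * theta a (of_nat N * z - of_real (T * of_int k))))"
  define pt where "pt = (\<lambda>(r :: int, s :: int). complex_of_real (T * of_int r / real N) - \<i> * complex_of_real (2 * pi * of_int s / real N))"
  have theta_comp: "(\<lambda>z. theta a (g z)) holomorphic_on UNIV" if "g holomorphic_on UNIV" for g
    using holomorphic_on_compose_gen[OF that theta_holomorphic[OF a]] by (simp add: o_def)
  have F_hol: "F holomorphic_on UNIV"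
    unfolding F_def by (intro holomorphic_intros theta_comp)
  have F_per: "F (z + 2 * pi * \<i>) = F z" for z
  proof -
    have 1: "exp (of_int k * (z + 2 * pi * \<i>) - of_real b) = exp (of_int k * z - of_real b)" for k :: int and b :: real
      unfolding exp_eq by (intro exI[of _ k]) (simp add: algebra_simps)
    have 2: "theta a (of_nat N * (z + 2 * pi * \<i>) - of_real b) = theta a (of_nat N * z - of_real b)" for b :: real
      by (rule theta_cong[OF a]) (unfold exp_eq, intro exI[of _ "int N"], simp add: algebra_simps)
    show ?thesis unfolding F_def 1 2 ..
  qed
  have F_shift: "F (z - of_real T) = of_real (exp a) * exp (- of_nat N * z) * F z" for z
  proof -
    have "exp (of_int k * (z - of_real T) - of_real b) * theta a (of_nat N * (z - of_real T) - of_real (T * of_int k)) =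
        of_real (exp a) * exp (- of_nat N * z) * (exp (of_int k * z - of_real b) * theta a (of_nat N * z - of_real (T * of_int k)))"
      for k :: int and b :: real
    proof -
      have "of_nat N * (z - of_real T) - of_real (T * of_int k) = (of_nat N * z - of_real (T * of_int k)) - of_real (2 * a)"
        by (simp add: a_def T_def algebra_simps)
      then have "theta a (of_nat N * (z - of_real T) - of_real (T * of_int k)) =
          exp (of_real a - (of_nat N * z - of_real (T * of_int k))) * theta a (of_nat N * z - of_real (T * of_int k))"
        by (simp only: theta_shift[OF a])
      moreover have "exp (of_int k * (z - of_real T) - of_real b) * exp (of_real a - (of_nat N * z - of_real (T * of_int k))) =
          of_real (exp a) * exp (- of_nat N * z) * exp (of_int k * z - of_real b)"
        unfolding exp_of_real[symmetric] mult_exp_exp by (rule arg_cong[where f = exp]) (simp add: algebra_simps)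
      ultimately show ?thesis by (simp only: mult.assoc[symmetric])
    qed
    note step = this
    show ?thesis unfolding F_def sum_distrib_left by (intro sum.cong refl) (simp only: step, simp only: mult_ac)
  qed
  have F_zero: "F (pt q) = 0" if "q \<in> Q" for q
  proof -
    obtain r s where q: "q = (r, s)" by (cases q)
    \<comment> \<open>With 2rk - k^2 = r^2 - (k-r)^2 and sk = s(k-r) + sr, the exponent at
      \<open>pt q\<close> splits into the one belonging to k - r and a factor free of k. The theta
      arguments differ by s periods 2 pi i, and \<open>cnj \<kappa>\<close> accounts for the free
      scalar in \<open>h\<close>.\<close>
    have "cnj \<kappa> * (exp (of_int k * pt q - of_real (pi * l * (of_int k)\<^sup>2 / real N)) * theta a (of_nat N * pt q - of_real (T * of_int k))) =
        exp (of_real (pi * l * (of_int r)\<^sup>2 / real N) - \<i> * of_real (2 * pi * of_int s * of_int r / real N)) *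
        cnj (cis (2 * pi * of_int s * of_int (k - r) / real N) * h (k - r))" for k
    proof -
      have "theta a (of_nat N * pt q - of_real (T * of_int k)) = theta a (of_real (T * of_int (- (k - r))))"
        by (rule theta_cong[OF a]) (unfold exp_eq, intro exI[of _ "- s"], use N0 in \<open>simp add: q pt_def field_simps\<close>)
      moreover have "cnj (h (k - r)) = cnj \<kappa> * of_real (exp (- (pi * l * (of_int (k - r))\<^sup>2 / real N))) *
          theta a (of_real (T * of_int (- (k - r))))"
        unfolding hk theta_of_real[OF a] by simp
      moreover have "exp (of_int k * pt q - of_real (pi * l * (of_int k)\<^sup>2 / real N)) =
        exp (of_real (pi * l * (of_int r)\<^sup>2 / real N) - \<i> * of_real (2 * pi * of_int s * of_int r / real N)) *
        cnj (cis (2 * pi * of_int s * of_int (k - r) / real N)) * of_real (exp (- (pi * l * (of_int (k - r))\<^sup>2 / real N)))"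
      proof -
        have "cnj (cis x) = exp (- (\<i> * of_real x))" for x
          by (metis cis_cnj cis_conv_exp mult_minus_right of_real_minus)
        then show ?thesis
          unfolding exp_of_real[symmetric] q pt_def
          by (simp only: mult_exp_exp, intro arg_cong[where f = exp])
            (use N0 in \<open>simp add: T_def field_simps power2_eq_square\<close>)
      qed
      ultimately show ?thesis by (simp only: complex_cnj_mult) (simp only: mult_ac)
    qed
    then have "cnj \<kappa> * F (pt q) =
        exp (of_real (pi * l * (of_int r)\<^sup>2 / real N) - \<i> * of_real (2 * pi * of_int s * of_int r / real N)) *
        (\<Sum>k\<in>{0..<int N}. c k * cnj (cis (2 * pi * of_int s * of_int (k - r) / real N) * h (k - r)))"
      unfolding F_def sum_distrib_left by (intro sum.cong refl) (simp only: mult.left_commute[of _ "c _"])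
    then show ?thesis using zero[of r s] that \<kappa> q by simp
  qed
  have pt_inj: "q = q'" if qq: "q \<in> Q" "q' \<in> Q" "pt q - pt q' \<in> period_lattice T" for q q'
  proof -
    obtain r s r' s' where q: "q = (r, s)" "q' = (r', s')" by (cases q, cases q')
    obtain k j where "pt q - pt q' = of_int k * (2 * pi * \<i>) + of_int j * of_real T"
      using qq(3) by (auto simp: period_lattice_def)
    then have "T * of_int r / real N - T * of_int r' / real N = of_int j * T"
      "2 * pi * of_int s' / real N - 2 * pi * of_int s / real N = of_int k * (2 * pi)"
      by (simp_all add: q pt_def complex_eq_iff)
    then have "real_of_int (r - r') = of_int (j * int N)" "real_of_int (s' - s) = of_int (k * int N)"
      using N0 T by (simp_all add: field_simps) (simp_all flip: distrib_left right_diff_distrib)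
    then have eqs: "r - r' = j * int N" "s' - s = k * int N" by (simp_all only: of_int_eq_iff)
    have small: "i = 0" if "\<bar>i * int N\<bar> < int N" for i
    proof -
      have "\<bar>i\<bar> * int N < 1 * int N" using that by (simp add: abs_mult)
      then show ?thesis by (simp only: mult_less_cancel_right) auto
    qed
    have "(r, s) \<in> {0..<int N} \<times> {0..<int N}" "(r', s') \<in> {0..<int N} \<times> {0..<int N}"
      using Q_sub qq(1,2) unfolding q by blast+
    then have "\<bar>r - r'\<bar> < int N" "\<bar>s' - s\<bar> < int N" by auto
    then have "j = 0" "k = 0" using small eqs by simp_all
    then show ?thesis using eqs q by simp
  qed
  have inj: "inj_on pt Q"
    using pt_inj period_latticeI[of 0 0 T] by (intro inj_onI) auto
  have F0: "F z = 0" for z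
  proof (rule ccontr)
    assume nz: "F z \<noteq> 0"
    have finQ: "finite Q" using Q_card N card_ge_0_finite by metis
    have card: "card (pt ` Q) = N" using inj Q_card by (simp add: card_image)
    have pt_image_inj: "p = p'" if "p \<in> pt ` Q" "p' \<in> pt ` Q" "p - p' \<in> period_lattice T" for p p'
      using that by (elim imageE) (metis pt_inj)
    have "\<exists>b::int. (-1) ^ card (pt ` Q) * of_real (exp a) * exp (- (\<Sum>p\<in>pt ` Q. p)) = complex_of_real (exp (- (of_int b * T)))"
      by (rule quasi_periodic_zeros_sum[where f = F and y = z, OF _ T _ F_hol F_per])
        (use finQ F_shift F_zero pt_image_inj nz in \<open>auto simp: card\<close>)
    then obtain b :: int where b: "(-1) ^ N * of_real (exp a) * exp (- (\<Sum>p\<in>pt ` Q. p)) = complex_of_real (exp (- (of_int b * T)))"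
      unfolding card by blast
    define R S where "R = (\<Sum>q\<in>Q. fst q)" and "S = (\<Sum>q\<in>Q. snd q)"
    have sum: "(\<Sum>p\<in>pt ` Q. p) = complex_of_real (T * of_int R / real N) - \<i> * complex_of_real (2 * pi * of_int S / real N)"
    proof -
      have "(\<Sum>p\<in>pt ` Q. p) = (\<Sum>q\<in>Q. pt q)"
        using inj by (simp only: sum.reindex o_def)
      also have "\<dots> = (\<Sum>q\<in>Q. complex_of_real (T / real N) * of_int (fst q) - \<i> * complex_of_real (2 * pi / real N) * of_int (snd q))"
        by (intro sum.cong refl) (simp add: pt_def case_prod_beta)
      also have "\<dots> = complex_of_real (T / real N) * of_int R - \<i> * complex_of_real (2 * pi / real N) * of_int S"
        unfolding sum_subtractf R_def S_def of_int_sum sum_distrib_left ..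
      finally show ?thesis by simp
    qed
    have e: "exp (- (\<Sum>p\<in>pt ` Q. p)) = of_real (exp (- (T * of_int R / real N))) * cis (2 * pi * of_int S / real N)"
      unfolding sum cis_conv_exp exp_of_real[symmetric] mult_exp_exp by (rule arg_cong[where f = exp]) simp
    \<comment> \<open>The identity \<open>b\<close> splits in two: its modulus constrains the sum
      \<open>R\<close> of the first coordinates, its phase the sum \<open>S\<close> of the
      second.\<close>
    have modulus: "exp a * exp (- (T * of_int R / real N)) = exp (- (of_int b * T))"
      using arg_cong[OF b, of norm] unfolding e
      by (simp only: norm_mult norm_power norm_of_real abs_exp_cancel norm_cis norm_minus_cancel norm_one
          power_one mult_1 mult_1_right)
    then have "a - T * of_int R / real N = - (of_int b * T)" by (simp add: mult_exp_exp)
    then have "T * (real N * real N + 2 * of_int b * real N) = T * (2 * of_int R)"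
      using N0 by (simp add: a_def T_def field_simps)
    then have "real N * real N + 2 * of_int b * real N = 2 * of_int R" using T by simp
    then have "real_of_int (int N * (int N + 2 * b)) = of_int (2 * R)" by (simp add: algebra_simps)
    then have R: "int N * (int N + 2 * b) = 2 * R" by (simp only: of_int_eq_iff)
    \<comment> \<open>The two factors have the same parity, so an even product makes
      \<open>N\<close> even. For odd \<open>N\<close> this is already the contradiction; for even
      \<open>N\<close> the sign (-1)^N disappears and both sums turn out to be 0 modulo
      \<open>N\<close>.\<close>
    have "even (int N * (int N + 2 * b))" unfolding R by simp
    then have "even N" by auto
    then obtain M where M: "N = 2 * M" by auto
    have "R = int N * (int M + b)" using R by (simp add: M algebra_simps)
    then have R0: "[R = 0] (mod int N)" by (simp add: cong_0_iff)
    have "of_real (exp a * exp (- (T * of_int R / real N))) * cis (2 * pi * of_int S / real N) = complex_of_real (exp (- (of_int b * T)))"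
      using b \<open>even N\<close> unfolding e by (simp add: mult.assoc)
    then have "cis (2 * pi * of_int S / real N) = 1"
      unfolding modulus by (metis exp_not_eq_zero mult_cancel_left1 of_real_eq_0_iff)
    then obtain q where "S = q * int N"
      using cis_2pi_div_eq_1_imp N by blast
    then have "[S = 0] (mod int N)" by (simp add: cong_0_iff)
    with R0 Q_sum \<open>even N\<close> show False by (simp add: R_def S_def)
  qed
  \<comment> \<open>At the points 2 pi i s / N the function \<open>F\<close> is the discrete Fourier
    transform of \<open>b\<close>, because there the theta arguments are -Tk modulo 2 pi i. Fourier
    inversion turns F = 0 into b = 0.\<close>
  define b where "b k = c k * (of_real (exp (- (pi * l * (of_int k)\<^sup>2 / real N))) * theta a (of_real (T * of_int (- k))))" for k
  have dft: "(\<Sum>k\<in>{0..<int N}. b k * cis (2 * pi * real s * of_int k / real N)) = 0" for s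
  proof -
    have "F (\<i> * of_real (2 * pi * real s / real N)) = (\<Sum>k\<in>{0..<int N}. b k * cis (2 * pi * real s * of_int k / real N))"
      unfolding F_def
    proof (intro sum.cong refl)
      fix k :: int
      have "theta a (of_nat N * (\<i> * of_real (2 * pi * real s / real N)) - of_real (T * of_int k)) = theta a (of_real (T * of_int (- k)))"
        by (rule theta_cong[OF a]) (unfold exp_eq, intro exI[of _ "int s"], use N0 in \<open>simp add: field_simps\<close>)
      moreover have "exp (of_int k * (\<i> * of_real (2 * pi * real s / real N)) - of_real (pi * l * (of_int k)\<^sup>2 / real N)) =
          of_real (exp (- (pi * l * (of_int k)\<^sup>2 / real N))) * cis (2 * pi * real s * of_int k / real N)"
        unfolding cis_conv_exp exp_of_real[symmetric] mult_exp_exp by (rule arg_cong[where f = exp]) simp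
      ultimately show "c k * (exp (of_int k * (\<i> * of_real (2 * pi * real s / real N)) - of_real (pi * l * (of_int k)\<^sup>2 / real N)) *
          theta a (of_nat N * (\<i> * of_real (2 * pi * real s / real N)) - of_real (T * of_int k))) =
          b k * cis (2 * pi * real s * of_int k / real N)"
        by (simp only: b_def mult_ac)
    qed
    then show ?thesis using F0 by simp
  qed
  have "0 = (\<Sum>s<N. cis (- (2 * pi * real s * of_int m / real N)) * (\<Sum>k\<in>{0..<int N}. b k * cis (2 * pi * real s * of_int k / real N)))"
    by (simp add: dft)
  also have "\<dots> = (\<Sum>k\<in>{0..<int N}. b k * (\<Sum>s<N. cis (2 * pi * real s * of_int (k - m) / real N)))"
  proof -
    have "cis (2 * pi * real s * of_int (k - m) / real N) =
        cis (- (2 * pi * real s * of_int m / real N)) * cis (2 * pi * real s * of_int k / real N)" for s k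
      unfolding cis_mult by (rule arg_cong[where f = cis]) (simp add: diff_divide_distrib right_diff_distrib)
    then show ?thesis
      unfolding sum_distrib_left by (subst sum.swap) (intro sum.cong refl, simp only: mult_ac)
  qed
  also have "\<dots> = (\<Sum>k\<in>{0..<int N}. if k = m then b k * of_nat N else 0)"
    by (intro sum.cong refl) (simp add: sum_roots_of_unity[OF _ m] del: of_int_diff)
  also have "\<dots> = b m * of_nat N" using m by (simp add: sum.delta)
  finally have "b m = 0" using N by simp
  moreover have "theta a (of_real (T * of_int (- m))) \<noteq> 0"
    unfolding theta_of_real[OF a] using theta_real_pos[OF a, of "T * of_int (- m)"] by (simp only: of_real_eq_0_iff)
  ultimately show ?thesis by (simp add: b_def)
qed

section \<open>Weyl operators on tensor products\<close>

lemma axis_zero: "axis i 0 = 0"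
  by (simp add: axis_def vec_eq_iff)

lemma X_op_funpow: "(X_op i ^^ n) c = (\<lambda>x. c (x - axis i (int n)))"
proof (induction n)
  case (Suc n)
  have "x - axis i 1 - axis i (int n) = x - axis i (int (Suc n))" for x :: "int^'a"
    by (simp add: vec_eq_iff axis_def)
  then show ?case by (simp only: funpow.simps o_apply Suc) (simp only: X_op_def)
qed (simp add: axis_zero)

lemma X_op_powi: "op_powi (X_op i) k c = (\<lambda>x. c (x - axis i k))"
proof (cases "k \<ge> 0")
  case True
  then show ?thesis by (simp add: op_powi_def X_op_funpow)
next
  case False
  have inv: "inv (X_op i) = (\<lambda>c x. c (x + axis i 1))"
    by (rule inv_unique_comp) (auto simp: X_op_def fun_eq_iff)
  have "((\<lambda>c x. c (x + axis i 1)) ^^ n) c = (\<lambda>x. c (x + axis i (int n)))" for n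
  proof (induction n)
    case (Suc n)
    have "x + axis i 1 + axis i (int n) = x + axis i (int (Suc n))" for x :: "int^'a"
      by (simp add: vec_eq_iff axis_def)
    then show ?case by (simp only: funpow.simps o_apply Suc)
  qed (simp add: axis_zero)
  moreover have "x + axis i (- k) = x - axis i k" for x
    by (simp add: vec_eq_iff axis_def)
  ultimately show ?thesis using False by (simp add: op_powi_def inv)
qed

lemma Z_op_powi: "op_powi (Z_op d i) k c = (\<lambda>x. cis (2 * pi * of_int k * of_int (x $ i) / real (d i)) * c x)"
proof (cases "k \<ge> 0")
  case True
  have "(Z_op d i ^^ n) c = (\<lambda>x. cis (2 * pi * real n * of_int (x $ i) / real (d i)) * c x)" for n
    by (induction n) (auto simp: Z_op_def cis_mult ring_distribs add_divide_distrib fun_eq_iff simp flip: mult.assoc)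
  with True show ?thesis by (simp add: op_powi_def)
next
  case False
  have inv: "inv (Z_op d i) = (\<lambda>c x. cis (- (2 * pi * of_int (x $ i) / real (d i))) * c x)"
    by (rule inv_unique_comp) (auto simp: Z_op_def fun_eq_iff cis_mult simp flip: mult.assoc)
  have "((\<lambda>c x. cis (- (2 * pi * of_int (x $ i) / real (d i))) * c x) ^^ n) c =
      (\<lambda>x. cis (- (2 * pi * real n * of_int (x $ i) / real (d i))) * c x)" for n
    by (induction n) (auto simp: cis_mult ring_distribs add_divide_distrib fun_eq_iff simp flip: mult.assoc)
  with False show ?thesis by (simp add: op_powi_def inv)
qed

lemma op_prod_shift:
  fixes c :: "'a::ab_group_add \<Rightarrow> 'b"
  assumes "\<And>i c. T i c = (\<lambda>x. c (x - f i))"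
  shows "op_prod T c = (\<lambda>x. c (x - (\<Sum>i\<in>UNIV. f i)))"
proof -
  have "foldr (\<circ>) (map T js) id c = (\<lambda>x. c (x - sum_list (map f js)))" for js
    by (induction js arbitrary: c) (auto simp: assms diff_diff_eq)
  moreover have "sum_list (map f (sorted_list_of_set UNIV)) = (\<Sum>i\<in>UNIV. f i)"
    by (simp add: sum_list_distinct_conv_sum_set)
  ultimately show ?thesis by (simp add: op_prod_def)
qed

lemma op_prod_multiplication:
  fixes c :: "'a \<Rightarrow> 'b::comm_monoid_mult"
  assumes "\<And>i c. T i c = (\<lambda>x. f i x * c x)"
  shows "op_prod T c = (\<lambda>x. (\<Prod>i\<in>UNIV. f i x) * c x)"
proof -
  have "foldr (\<circ>) (map T js) id c = (\<lambda>x. prod_list (map (\<lambda>i. f i x) js) * c x)" for js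
    by (induction js arbitrary: c) (auto simp: assms mult_ac)
  moreover have "prod_list (map (\<lambda>i. f i x) (sorted_list_of_set UNIV)) = (\<Prod>i\<in>UNIV. f i x)" for x
    by (simp add: prod.distinct_set_conv_list[symmetric])
  ultimately show ?thesis by (simp add: op_prod_def)
qed

text \<open>This is X^r Z^s h without the Weyl phase. Unlike the phase, it depends only on residues
  when \<open>h\<close> is periodic.\<close>

definition weyl_1d :: "nat \<Rightarrow> (int \<Rightarrow> complex) \<Rightarrow> int \<times> int \<Rightarrow> int \<Rightarrow> complex" where
  "weyl_1d N h = (\<lambda>(r, s) k. cis (2 * pi * of_int s * of_int (k - r) / real N) * h (k - r))"

lemma weyl_tensor:
  "weyl d (r, s) (tensor h) x =
     cis (pi * (\<Sum>j\<in>UNIV. of_int (r $ j) * of_int (s $ j) / real (d j))) *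
     (\<Prod>j\<in>UNIV. weyl_1d (d j) (h j) (r $ j, s $ j) (x $ j))"
proof -
  have "(\<Sum>i\<in>UNIV. axis i (r $ i)) = r"
    by (simp add: vec_eq_iff axis_def sum.delta if_distrib cong: if_cong)
  then show ?thesis
    by (simp only: weyl_def cscale_def op_prod_shift[OF X_op_powi] op_prod_multiplication[OF Z_op_powi]
        tensor_def weyl_1d_def prod.distrib case_prod_conv vector_minus_component)
qed

lemma weyl_1d_cong:
  assumes N: "N > 0" and h: "\<And>k k'. [k = k'] (mod int N) \<Longrightarrow> h k = h k'"
    and r: "[r = r'] (mod int N)" and s: "[s = s'] (mod int N)" and k: "[k = k'] (mod int N)"
  shows "weyl_1d N h (r, s) k = weyl_1d N h (r', s') k'"
proof -
  have "[s * (k - r) = s' * (k' - r')] (mod int N)"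
    by (intro cong_mult cong_diff r s k)
  then obtain q where q: "s * (k - r) = s' * (k' - r') + int N * q"
    by (metis cong_iff_lin cong_sym)
  have "2 * pi * of_int s * of_int (k - r) / real N = 2 * pi * of_int (s * (k - r)) / real N"
    by simp
  also have "\<dots> = 2 * pi * of_int s' * of_int (k' - r') / real N + 2 * pi * of_int q"
    unfolding q using N by (simp add: field_simps)
  finally have "cis (2 * pi * of_int s * of_int (k - r) / real N) = cis (2 * pi * of_int s' * of_int (k' - r') / real N)"
    by (simp only: cis_mult[symmetric] cis_multiple_2pi Ints_of_int mult_1_right)
  moreover have "h (k - r) = h (k' - r')"
    by (intro h cong_diff r k)
  ultimately show ?thesis by (simp add: weyl_1d_def)
qed

section \<open>Left inverses of tensor products\<close>

lemma sum_fun_apply: "(\<Sum>i\<in>A. f i) x = (\<Sum>i\<in>A. f i x)" for f :: "'a \<Rightarrow> 'b \<Rightarrow> 'c::comm_monoid_add"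
  by (induction A rule: infinite_finite_induct) auto

text \<open>Trivial kernels do not combine directly over several coordinates, whereas left inverse
  matrices can be multiplied entrywise. The matrix \<open>M\<close> consists of the values on unit
  vectors of a linear left inverse, taken on the functions supported on \<open>K\<close>.\<close>

lemma injective_imp_left_inverse:
  fixes b :: "'q \<Rightarrow> 'k \<Rightarrow> complex"
  assumes K: "finite K" and Q: "finite Q"
    and inj: "\<And>c k. (\<And>q. q \<in> Q \<Longrightarrow> (\<Sum>k\<in>K. c k * b q k) = 0) \<Longrightarrow> k \<in> K \<Longrightarrow> c k = 0"
  shows "\<exists>M. \<forall>k\<in>K. \<forall>k'\<in>K. (\<Sum>q\<in>Q. M k q * b q k') = (if k = k' then 1 else 0)"
proof -
  interpret P: vector_space_pair "cscale :: complex \<Rightarrow> ('k \<Rightarrow> complex) \<Rightarrow> _" "cscale :: complex \<Rightarrow> ('q \<Rightarrow> complex) \<Rightarrow> _"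
    by unfold_locales
  interpret P': vector_space_pair "cscale :: complex \<Rightarrow> ('q \<Rightarrow> complex) \<Rightarrow> _" "cscale :: complex \<Rightarrow> ('k \<Rightarrow> complex) \<Rightarrow> _"
    by unfold_locales
  define f :: "('k \<Rightarrow> complex) \<Rightarrow> 'q \<Rightarrow> complex" where
    "f c q = (if q \<in> Q then \<Sum>k\<in>K. c k * b q k else 0)" for c q
  define V where "V = {c :: 'k \<Rightarrow> complex. \<forall>k. k \<notin> K \<longrightarrow> c k = 0}"
  have lin: "Vector_Spaces.linear cscale cscale f"
    by (intro Vector_Spaces.linear.intro, unfold_locales) (auto simp: f_def cscale_def fun_eq_iff ring_distribs sum.distrib sum_distrib_left mult.assoc)
  have sub: "cfun.subspace V"
    by (auto simp: V_def cfun.subspace_def cscale_def)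
  have "inj_on f V"
  proof (rule inj_onI)
    fix c c' assume c: "c \<in> V" "c' \<in> V" "f c = f c'"
    have "c k - c' k = 0" if "k \<in> K" for k
    proof (rule inj[OF _ that])
      fix q assume "q \<in> Q"
      then show "(\<Sum>k\<in>K. (c k - c' k) * b q k) = 0"
        using fun_cong[OF c(3), of q] by (simp add: f_def left_diff_distrib sum_subtractf)
    qed
    then show "c = c'" using c by (fastforce simp: V_def fun_eq_iff)
  qed
  from P.linear_exists_left_inverse_on[OF lin sub this]
  obtain g where lin_g: "Vector_Spaces.linear cscale cscale g" and gf: "\<And>c. c \<in> V \<Longrightarrow> g (f c) = c"
    by blast
  define e :: "'q \<Rightarrow> 'q \<Rightarrow> complex" where "e q = (\<lambda>q'. if q' = q then 1 else 0)" for q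
  have "(\<Sum>q\<in>Q. g (e q) k * b q k') = (if k = k' then 1 else 0)" if k: "k \<in> K" "k' \<in> K" for k k'
  proof -
    define c where "c = (\<lambda>x. if x = k' then 1 else 0 :: complex)"
    have "c \<in> V" using k by (auto simp: c_def V_def)
    have "f c = (\<Sum>q\<in>Q. cscale (b q k') (e q))"
      using K Q k by (auto simp: f_def c_def fun_eq_iff sum_fun_apply cscale_def e_def mult_delta_left mult_delta_right)
    then have "g (f c) = (\<Sum>q\<in>Q. cscale (b q k') (g (e q)))"
      by (simp add: P'.linear_sum[OF lin_g] P'.linear_scale[OF lin_g])
    then have "c k = (\<Sum>q\<in>Q. b q k' * g (e q) k)"
      using gf[OF \<open>c \<in> V\<close>] by (simp add: sum_fun_apply cscale_def)
    then show ?thesis by (simp add: c_def mult.commute)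
  qed
  then show ?thesis by (intro exI[of _ "\<lambda>k q. g (e q) k"]) auto
qed

lemma bij_betw_PiE_Q_prod:
  "bij_betw (\<lambda>f. (\<chi> j. fst (f j), \<chi> j. snd (f j))) (PiE UNIV Q) (Q_prod Q)"
  by (rule bij_betwI[where g = "\<lambda>(r :: (int, _) vec, s :: (int, _) vec) j. (r $ j, s $ j)"])
    (auto simp: Q_prod_def PiE_iff vec_eq_iff fun_eq_iff)

lemma bij_betw_PiE_Zd: "bij_betw (\<lambda>f. \<chi> j. f j) (PiE UNIV (\<lambda>j. {0..<int (d j)})) (Zd d)"
  by (rule bij_betwI[where g = "\<lambda>(r :: (int, _) vec) j. r $ j"]) (auto simp: Zd_def PiE_iff)

lemma card_Q_prod: "card (Q_prod Q) = (\<Prod>j\<in>UNIV. card (Q j))"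
  using bij_betw_same_card[OF bij_betw_PiE_Q_prod[of Q]] by (simp add: card_PiE)

lemma card_Zd: "card (Zd d) = (\<Prod>j\<in>UNIV. d j)"
  using bij_betw_same_card[OF bij_betw_PiE_Zd[of d]] by (simp add: card_PiE)

lemma finite_Zd: "finite (Zd d)"
  using bij_betw_finite[OF bij_betw_PiE_Zd[of d]] by (simp add: finite_PiE)

lemma finite_Q_prod: "(\<And>j. finite (Q j)) \<Longrightarrow> finite (Q_prod Q)"
  using bij_betw_finite[OF bij_betw_PiE_Q_prod[of Q]] by (simp add: finite_PiE)

text \<open>Distributivity over a product index set; it is the reason that coordinatewise left
  inverses multiply to a left inverse for \<open>Q_prod\<close>.\<close>

lemma sum_Q_prod_prod:
  fixes f :: "'n::finite \<Rightarrow> int \<times> int \<Rightarrow> 'b::comm_semiring_1"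
  assumes "\<And>j. finite (Q j)"
  shows "(\<Sum>(r, s)\<in>Q_prod Q. \<Prod>j\<in>UNIV. f j (r $ j, s $ j)) = (\<Prod>j\<in>UNIV. \<Sum>q\<in>Q j. f j q)"
proof -
  have "(\<Sum>(r, s)\<in>Q_prod Q. \<Prod>j\<in>UNIV. f j (r $ j, s $ j)) = (\<Sum>g\<in>PiE UNIV Q. \<Prod>j\<in>UNIV. f j (g j))"
    by (subst sum.reindex_bij_betw[OF bij_betw_PiE_Q_prod, symmetric]) simp
  also have "\<dots> = (\<Prod>j\<in>UNIV. \<Sum>q\<in>Q j. f j q)"
    using assms by (simp add: prod_sum_PiE)
  finally show ?thesis .
qed

section \<open>Bases and coordinates\<close>

context
  fixes d :: "'n::finite \<Rightarrow> nat"
  assumes d_pos: "\<And>j. d j > 0"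
begin

definition Zd_repr :: "int^'n \<Rightarrow> int^'n" where
  "Zd_repr x = (\<chi> j. x $ j mod int (d j))"

lemma Zd_repr: "Zd_repr x \<in> Zd d" "cong_d d x (Zd_repr x)"
  using d_pos by (auto simp: Zd_repr_def Zd_def cong_d_def cong_def)

lemma Hd_eqI:
  assumes "c \<in> Hd d" "c' \<in> Hd d" "\<And>x. x \<in> Zd d \<Longrightarrow> c x = c' x"
  shows "c = c'"
proof
  fix x
  have "c x = c (Zd_repr x)" "c' x = c' (Zd_repr x)"
    using assms(1,2) Zd_repr(2) by (auto simp: Hd_def)
  then show "c x = c' x" using assms(3)[OF Zd_repr(1)] by simp
qed

lemma e_vec_Zd:
  assumes "x \<in> Zd d" "r \<in> Zd d"
  shows "e_vec d r x = (if x = r then 1 else 0)"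
proof -
  have "cong_d d x r \<longleftrightarrow> x = r"
    using assms by (auto simp: cong_d_def Zd_def vec_eq_iff cong_def mod_pos_pos_trivial)
  then show ?thesis by (simp add: e_vec_def)
qed

lemma e_vec_Hd: "e_vec d r \<in> Hd d"
proof -
  have "cong_d d x r \<longleftrightarrow> cong_d d y r" if "cong_d d x y" for x y
    using that unfolding cong_d_def by (meson cong_trans cong_sym)
  then show ?thesis by (simp add: Hd_def e_vec_def)
qed

lemma Hd_subspace: "cfun.subspace (Hd d)"
  by (auto simp: cfun.subspace_def Hd_def cscale_def)

lemma sum_scale_Hd: "(\<And>i. i \<in> I \<Longrightarrow> w i \<in> Hd d) \<Longrightarrow> (\<Sum>i\<in>I. cscale (a i) (w i)) \<in> Hd d"
  using Hd_subspace by (intro cfun.subspace_sum cfun.subspace_scale) auto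

lemma Hd_expand:
  assumes "c \<in> Hd d"
  shows "c = (\<Sum>r\<in>Zd d. cscale (c r) (e_vec d r))"
  by (rule Hd_eqI[OF assms sum_scale_Hd[OF e_vec_Hd]])
    (auto simp: sum_fun_apply cscale_def e_vec_Zd sum.delta finite_Zd if_distrib cong: if_cong)

lemma inj_on_e_vec: "inj_on (e_vec d) (Zd d)"
proof (rule inj_onI)
  fix r r' assume r: "r \<in> Zd d" "r' \<in> Zd d" "e_vec d r = e_vec d r'"
  then show "r = r'" using e_vec_Zd[of r r] e_vec_Zd[of r r'] by (auto split: if_splits)
qed

lemma independent_e_vec: "cfun.independent (e_vec d ` Zd d)"
proof (rule cfun.independent_if_scalars_zero)
  fix f x assume sum: "(\<Sum>x\<in>e_vec d ` Zd d. cscale (f x) x) = 0" and "x \<in> e_vec d ` Zd d"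
  then obtain r where r: "r \<in> Zd d" "x = e_vec d r" by blast
  have "(\<Sum>r'\<in>Zd d. cscale (f (e_vec d r')) (e_vec d r')) r = 0"
    using sum inj_on_e_vec by (simp add: sum.reindex)
  then show "f x = 0"
    using r by (simp add: sum_fun_apply cscale_def e_vec_Zd sum.delta finite_Zd if_distrib cong: if_cong)
qed (simp add: finite_Zd)

text \<open>The matrix \<open>M\<close> writes every unit vector as a combination of the family,
  which therefore spans; having as many members as the dimension, it is a basis. The conjugate of
  \<open>M\<close> reconstructs a vector from its inner products, which gives the last
  claim.\<close>

lemma dual_system_imp_basis:
  fixes w :: "'i \<Rightarrow> int^'n \<Rightarrow> complex"
  assumes I: "finite I" "card I = (\<Prod>j\<in>UNIV. d j)" and w: "\<And>i. i \<in> I \<Longrightarrow> w i \<in> Hd d"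
    and M: "\<And>k x. k \<in> Zd d \<Longrightarrow> x \<in> Zd d \<Longrightarrow> (\<Sum>i\<in>I. M k i * w i x) = (if k = x then 1 else 0)"
  shows "inj_on w I" "cfun.independent (w ` I)" "cfun.span (w ` I) = Hd d"
    and "\<And>c c'. c \<in> Hd d \<Longrightarrow> c' \<in> Hd d \<Longrightarrow> (\<And>i. i \<in> I \<Longrightarrow> Hd_inner d c (w i) = Hd_inner d c' (w i)) \<Longrightarrow> c = c'"
proof -
  have e: "e_vec d k \<in> cfun.span (w ` I)" if k: "k \<in> Zd d" for k
  proof -
    have "e_vec d k = (\<Sum>i\<in>I. cscale (M k i) (w i))"
      by (rule Hd_eqI[OF e_vec_Hd sum_scale_Hd[OF w]]) (auto simp: sum_fun_apply cscale_def M k e_vec_Zd)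
    then show ?thesis by (simp only:) (intro cfun.span_sum cfun.span_scale cfun.span_base imageI)
  qed
  \<comment> \<open>Exchange against the unit vectors gives card I <= card B, while B lies in the
    image of I. All cardinalities coincide, which yields injectivity and independence
    together.\<close>
  obtain B where B: "B \<subseteq> w ` I" "cfun.independent B" "w ` I \<subseteq> cfun.span B"
    using cfun.maximal_independent_subset by blast
  have finB: "finite B" using B(1) I(1) finite_subset by blast
  have "cfun.span (w ` I) \<subseteq> cfun.span B"
    using B(3) by (simp add: cfun.span_minimal)
  then have "e_vec d ` Zd d \<subseteq> cfun.span B" using e by blast
  then have "card (e_vec d ` Zd d) \<le> card B"
    using cfun.independent_span_bound[OF finB independent_e_vec] by blast
  then have "card I \<le> card B"
    using inj_on_e_vec I(2) by (simp add: card_image card_Zd)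
  moreover have "card B \<le> card (w ` I)" "card (w ` I) \<le> card I"
    using B(1) I(1) by (auto intro: card_mono card_image_le)
  ultimately have card: "card (w ` I) = card I" "card B = card (w ` I)" by auto
  show "inj_on w I" using I(1) card(1) by (rule eq_card_imp_inj_on)
  have "B = w ` I" using card_subset_eq[OF _ B(1) card(2)] I(1) by simp
  then show "cfun.independent (w ` I)" using B(2) by simp
  show "cfun.span (w ` I) = Hd d"
  proof
    show "cfun.span (w ` I) \<subseteq> Hd d"
      using w by (intro cfun.span_minimal Hd_subspace) auto
    show "Hd d \<subseteq> cfun.span (w ` I)"
    proof
      fix c assume "c \<in> Hd d"
      then show "c \<in> cfun.span (w ` I)"
        using Hd_expand e by (metis (no_types, lifting) cfun.span_scale cfun.span_sum)
    qed
  qed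
  fix c c' assume c: "c \<in> Hd d" "c' \<in> Hd d" and eq: "\<And>i. i \<in> I \<Longrightarrow> Hd_inner d c (w i) = Hd_inner d c' (w i)"
  have coord: "u k = (\<Sum>i\<in>I. cnj (M k i) * Hd_inner d u (w i))" if k: "k \<in> Zd d" for u k
  proof -
    have "(\<Sum>i\<in>I. cnj (M k i) * Hd_inner d u (w i)) = (\<Sum>x\<in>Zd d. u x * cnj (\<Sum>i\<in>I. M k i * w i x))"
      unfolding Hd_inner_def sum_distrib_left cnj_sum
      by (subst sum.swap) (simp add: mult_ac)
    also have "\<dots> = u k"
      using k by (simp add: M sum.delta finite_Zd if_distrib cong: if_cong)
    finally show ?thesis ..
  qed
  show "c = c'"
    by (rule Hd_eqI[OF c]) (simp add: coord eq)
qed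

lemma linear_functional_on_sum:
  assumes \<phi>: "linear_functional_on (Hd d) \<phi>" and w: "\<And>i. i \<in> I \<Longrightarrow> w i \<in> Hd d"
  shows "\<phi> (\<Sum>i\<in>I. cscale (a i) (w i)) = (\<Sum>i\<in>I. a i * \<phi> (w i))"
  using w
proof (induction I rule: infinite_finite_induct)
  case (insert i I)
  then have "\<phi> (cscale (a i) (w i) + (\<Sum>i\<in>I. cscale (a i) (w i))) =
      \<phi> (cscale (a i) (w i)) + \<phi> (\<Sum>i\<in>I. cscale (a i) (w i))"
    using \<phi> cfun.subspace_scale[OF Hd_subspace] by (simp add: linear_functional_on_def sum_scale_Hd)
  with insert \<phi> show ?case
    by (simp add: linear_functional_on_def del: plus_fun_apply)
next
  \<comment> \<open>Both sums are 0 by convention, so what remains is that \<phi> vanishes at 0,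
    obtained by scaling with 0.\<close>
  case (infinite A)
  have "\<phi> (cscale 0 (e_vec d 0)) = 0 * \<phi> (e_vec d 0)"
    using \<phi> e_vec_Hd unfolding linear_functional_on_def by blast
  then show ?case
    by (simp only: sum.infinite[OF infinite.hyps(1)] cfun.scale_zero_left mult_zero_left)
next
  case empty
  have "\<phi> (cscale 0 (e_vec d 0)) = 0 * \<phi> (e_vec d 0)"
    using \<phi> e_vec_Hd unfolding linear_functional_on_def by blast
  then show ?case by (simp only: sum.empty cfun.scale_zero_left mult_zero_left)
qed

text \<open>The value vectors \<open>u r\<close> of the unit vectors are independent in the space of
  functions on \<open>I\<close>: a vanishing combination would give a vector with the same values as
  0. Linearity is essential, since a single arbitrary function could already be injective.\<close>

lemma card_determining_functionals:
  assumes I: "finite I" and \<phi>: "\<And>i. i \<in> I \<Longrightarrow> linear_functional_on (Hd d) (\<phi> i)"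
    and det: "determines I \<phi> (Hd d)"
  shows "(\<Prod>j\<in>UNIV. d j) \<le> card I"
proof -
  define \<delta> :: "'a \<Rightarrow> 'a \<Rightarrow> complex" where "\<delta> i = (\<lambda>k. if k = i then 1 else 0)" for i
  define u where "u r = (\<lambda>i. if i \<in> I then \<phi> i (e_vec d r) else 0)" for r
  have inj: "inj_on u (Zd d)"
  proof (rule inj_onI)
    fix r r' assume r: "r \<in> Zd d" "r' \<in> Zd d" "u r = u r'"
    have "\<phi> i (e_vec d r) = \<phi> i (e_vec d r')" if "i \<in> I" for i
      using fun_cong[OF r(3), of i] that by (simp add: u_def)
    then have "e_vec d r = e_vec d r'"
      using det e_vec_Hd unfolding determines_def by blast
    then show "r = r'" using inj_on_e_vec r by (auto dest: inj_onD)
  qed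
  have "cfun.independent (u ` Zd d)"
  proof (rule cfun.independent_if_scalars_zero)
    fix f x assume sum: "(\<Sum>x\<in>u ` Zd d. cscale (f x) x) = 0" and "x \<in> u ` Zd d"
    then obtain r where r: "r \<in> Zd d" "x = u r" by blast
    define c where "c = (\<Sum>r\<in>Zd d. cscale (f (u r)) (e_vec d r))"
    have c: "c \<in> Hd d" unfolding c_def by (intro sum_scale_Hd e_vec_Hd)
    have zero: "(\<Sum>r\<in>Zd d. cscale (f (u r)) (u r)) = 0"
      using sum inj by (simp add: sum.reindex)
    have "\<phi> i c = 0" if "i \<in> I" for i
      using fun_cong[OF zero, of i] that linear_functional_on_sum[where w = "e_vec d" and I = "Zd d" and a = "\<lambda>r. f (u r)", OF \<phi>[OF that] e_vec_Hd]
      by (simp add: c_def sum_fun_apply cscale_def u_def)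
    moreover have "\<phi> i 0 = 0" if "i \<in> I" for i
      using linear_functional_on_sum[where w = "e_vec d" and I = "{}", OF \<phi>[OF that] e_vec_Hd] by simp
    moreover have "0 \<in> Hd d" using cfun.subspace_0[OF Hd_subspace] .
    ultimately have "c = 0"
      using det c unfolding determines_def by metis
    have "c r = f (u r)"
      using r by (simp add: c_def sum_fun_apply cscale_def e_vec_Zd sum.delta finite_Zd if_distrib cong: if_cong)
    then show "f x = 0" using \<open>c = 0\<close> r by simp
  qed (simp add: finite_Zd)
  moreover have "u ` Zd d \<subseteq> cfun.span (\<delta> ` I)"
  proof (rule image_subsetI)
    fix r
    have "u r = (\<Sum>i\<in>I. cscale (u r i) (\<delta> i))"
      using I by (auto simp: fun_eq_iff sum_fun_apply cscale_def \<delta>_def u_def sum.delta' if_distrib cong: if_cong)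
    also have "\<dots> \<in> cfun.span (\<delta> ` I)"
      by (intro cfun.span_sum cfun.span_scale cfun.span_base) auto
    finally show "u r \<in> cfun.span (\<delta> ` I)" .
  qed
  ultimately have "card (u ` Zd d) \<le> card (\<delta> ` I)"
    using cfun.independent_span_bound I by blast
  also have "\<dots> \<le> card I" using I by (rule card_image_le)
  finally show ?thesis using inj by (simp add: card_image card_Zd)
qed

end

section \<open>Assembling the coordinates into a basis of the tensor product\<close>

theorem corollary5p11:
  fixes d :: "'n::{finite,linorder} \<Rightarrow> nat"
    and g :: "'m::finite \<Rightarrow> (real, 'n) vec \<Rightarrow> complex"
    and \<alpha> :: "complex^'m"
    and v :: "(int, 'n) vec \<Rightarrow> complex"
    and l :: "'n \<Rightarrow> real"
    and h :: "'n \<Rightarrow> int \<Rightarrow> complex"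
    and Qs :: "'n \<Rightarrow> (int \<times> int) set"
    and \<rho> :: "(int, 'n) vec \<times> (int, 'n) vec \<Rightarrow> (int, 'n) vec \<times> (int, 'n) vec"
  assumes d_pos: "\<And>j. d j > 0"
    and d_dvd: "\<And>i j. i \<le> j \<Longrightarrow> d i dvd d j"
    and g_M1: "\<And>s. g s \<in> M1"
    and frame: "multiwindow_gabor_frame d g"
    and v_def: "v = (\<Sum>s\<in>UNIV. cscale (cnj (\<alpha> $ s)) (zak_vec d (g s) 0 0))"
    and l_pos: "\<And>j. l j > 0"
    and h_gauss: "\<And>j. is_sampled_gaussian (d j) (l j) (h j)"
    and v_tensor: "v = tensor h"
    and Q_sub: "\<And>j. Qs j \<subseteq> {0..<int (d j)} \<times> {0..<int (d j)}"
    and Q_card: "\<And>j. card (Qs j) = d j"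
    and Q_sum: "\<And>j. odd (d j) \<or>
      \<not> ([(\<Sum>q\<in>Qs j. fst q) = 0] (mod int (d j)) \<and> [(\<Sum>q\<in>Qs j. snd q) = 0] (mod int (d j)))"
    and repr: "is_repr d \<rho>"
  shows "(inj_on (\<lambda>q. weyl d (\<rho> q) v) (Q_prod Qs) \<and>
      cfun.independent ((\<lambda>q. weyl d (\<rho> q) v) ` Q_prod Qs) \<and>
      cfun.span ((\<lambda>q. weyl d (\<rho> q) v) ` Q_prod Qs) = Hd d) \<and>
    (determines (Q_prod Qs) (\<lambda>q. B0 d v (\<rho> q)) (Hd d) \<and>
      card (Q_prod Qs) = (\<Prod>j\<in>UNIV. d j) \<and>
      (\<forall>(I :: nat set) \<phi>. finite I \<and> (\<forall>i\<in>I. linear_functional_on (Hd d) (\<phi> i)) \<and>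
         determines I \<phi> (Hd d) \<longrightarrow> (\<Prod>j\<in>UNIV. d j) \<le> card I))"
proof -
  define u where "u j = weyl_1d (d j) (h j)" for j
  define ph where "ph q = cis (pi * (\<Sum>j\<in>UNIV. of_int (fst (\<rho> q) $ j) * of_int (snd (\<rho> q) $ j) / real (d j)))" for q
  define w where "w q = weyl d (\<rho> q) v" for q
  have finQ: "finite (Qs j)" for j
    using Q_card d_pos[of j] card_ge_0_finite by metis
  have h_periodic: "h j k = h j k'" if "[k = k'] (mod int (d j))" for j k k'
    using h_gauss that by (rule sampled_gaussian_periodic)
  have w_eq: "w (r, s) x = ph (r, s) * (\<Prod>j\<in>UNIV. u j (r $ j, s $ j) (x $ j))"
    if "(r, s) \<in> Q_prod Qs" for r s x
  proof -
    have "(r, s) \<in> KD d"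
      using that Q_sub by (fastforce simp: KD_def Zd_def Q_prod_def)
    moreover obtain r' s' where \<rho>: "\<rho> (r, s) = (r', s')" by fastforce
    ultimately have "cong_d d r' r" "cong_d d s' s"
      using repr by (auto simp: is_repr_def)
    then have "u j (r' $ j, s' $ j) (x $ j) = u j (r $ j, s $ j) (x $ j)" for j
      unfolding u_def by (intro weyl_1d_cong d_pos h_periodic) (auto simp: cong_d_def)
    then show ?thesis
      by (simp add: w_def \<rho> v_tensor weyl_tensor ph_def u_def)
  qed
  have w_Hd: "w q \<in> Hd d" if "q \<in> Q_prod Qs" for q
  proof -
    obtain r s where q: "q = (r, s)" by fastforce
    have "w q x = w q x'" if "cong_d d x x'" for x x'
    proof -
      have "u j (r $ j, s $ j) (x $ j) = u j (r $ j, s $ j) (x' $ j)" for j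
        unfolding u_def using that by (intro weyl_1d_cong d_pos h_periodic) (auto simp: cong_d_def)
      then show ?thesis using w_eq \<open>q \<in> Q_prod Qs\<close> by (simp add: q)
    qed
    then show ?thesis by (auto simp: Hd_def)
  qed
  have "\<exists>M. \<forall>k\<in>{0..<int (d j)}. \<forall>k'\<in>{0..<int (d j)}.
      (\<Sum>q\<in>Qs j. M k q * cnj (u j q k')) = (if k = k' then 1 else 0)" for j
  proof (rule injective_imp_left_inverse)
    fix c k assume zero: "\<And>q. q \<in> Qs j \<Longrightarrow> (\<Sum>k\<in>{0..<int (d j)}. c k * cnj (u j q k)) = 0"
      and k: "k \<in> {0..<int (d j)}"
    show "c k = 0"
      by (rule sampled_gaussian_weyl_injective[OF d_pos l_pos h_gauss Q_sub Q_card Q_sum _ k])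
        (use zero in \<open>force simp: u_def weyl_1d_def\<close>)
  qed (auto simp: finQ)
  then obtain M where M: "\<And>j k k'. k \<in> {0..<int (d j)} \<Longrightarrow> k' \<in> {0..<int (d j)} \<Longrightarrow>
      (\<Sum>q\<in>Qs j. M j k q * cnj (u j q k')) = (if k = k' then 1 else 0)"
    by metis
  \<comment> \<open>Orthogonality involves the conjugates of \<open>u\<close>, so \<open>M\<close>
    inverts the conjugated matrices and has to be conjugated back; the first factor undoes the
    phase.\<close>
  define M' where "M' k = (\<lambda>(r, s). inverse (ph (r, s)) * (\<Prod>j\<in>UNIV. cnj (M j (k $ j) (r $ j, s $ j))))"
    for k :: "(int, 'n) vec"
  have dual: "(\<Sum>q\<in>Q_prod Qs. M' k q * w q x) = (if k = x then 1 else 0)" if "k \<in> Zd d" "x \<in> Zd d" for k x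
  proof -
    have ph: "ph q \<noteq> 0" for q by (simp add: ph_def)
    have "(\<Sum>q\<in>Q_prod Qs. M' k q * w q x) =
        (\<Sum>(r, s)\<in>Q_prod Qs. \<Prod>j\<in>UNIV. cnj (M j (k $ j) (r $ j, s $ j)) * u j (r $ j, s $ j) (x $ j))"
      by (intro sum.cong refl) (auto simp: M'_def w_eq ph prod.distrib)
    also have "\<dots> = (\<Prod>j\<in>UNIV. \<Sum>q\<in>Qs j. cnj (M j (k $ j) q) * u j q (x $ j))"
      using finQ by (rule sum_Q_prod_prod)
    also have "\<dots> = (\<Prod>j\<in>UNIV. cnj (\<Sum>q\<in>Qs j. M j (k $ j) q * cnj (u j q (x $ j))))"
      by simp
    also have "\<dots> = (\<Prod>j\<in>UNIV. if k $ j = x $ j then 1 else 0)"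
      using that by (intro prod.cong refl) (subst M, auto simp: Zd_def)
    also have "\<dots> = (if k = x then 1 else 0)"
      by (auto simp: vec_eq_iff)
    finally show ?thesis .
  qed
  have card: "card (Q_prod Qs) = (\<Prod>j\<in>UNIV. d j)"
    by (simp add: card_Q_prod Q_card)
  note basis = dual_system_imp_basis[where w = w and M = M', OF d_pos finite_Q_prod[OF finQ] card w_Hd dual]
  \<comment> \<open>Division by zero yields 0, so a vanishing norm would make every coefficient
    \<open>B0\<close> equal to 0. It is excluded because the entries of the sampled Gaussians are
    nonzero.\<close>
  have norm: "Hd_norm d v > 0"
  proof -
    have "0 < (\<Sum>r\<in>Zd d. (cmod (v r))\<^sup>2)"
    proof (rule sum_pos)
      show "Zd d \<noteq> {}" using d_pos by (auto simp: Zd_def intro!: exI[of _ 0])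
      show "0 < (cmod (v r))\<^sup>2" for r
        using sampled_gaussian_nonzero[OF d_pos l_pos h_gauss] by (simp add: v_tensor tensor_def)
    qed (rule finite_Zd)
    then show ?thesis by (simp add: Hd_norm_def)
  qed
  have "determines (Q_prod Qs) (\<lambda>q. B0 d v (\<rho> q)) (Hd d)"
    unfolding determines_def
  proof (intro ballI impI)
    fix c c' assume c: "c \<in> Hd d" "c' \<in> Hd d" and eq: "\<forall>q\<in>Q_prod Qs. B0 d v (\<rho> q) c = B0 d v (\<rho> q) c'"
    have "Hd_inner d c (w q) = Hd_inner d c' (w q)" if "q \<in> Q_prod Qs" for q
    proof -
      have "1 / complex_of_real (sqrt (real (\<Prod>j\<in>UNIV. d j)) * Hd_norm d v) \<noteq> 0"
        using norm d_pos by (simp add: prod_pos less_imp_neq[symmetric])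
      then show ?thesis
        using bspec[OF eq that] unfolding B0_def w_def by (rule iffD1[OF mult_left_cancel])
    qed
    then show "c = c'" using basis(4) c by blast
  qed
  moreover have "(\<Prod>j\<in>UNIV. d j) \<le> card I"
    if "finite I \<and> (\<forall>i\<in>I. linear_functional_on (Hd d) (\<phi> i)) \<and> determines I \<phi> (Hd d)"
    for I :: "nat set" and \<phi>
    using that by (intro card_determining_functionals[OF d_pos]) auto
  ultimately show ?thesis
    using basis(1-3) card unfolding w_def by (intro conjI allI impI)
qed

end
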